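(* Let $n\geq 6$ and let $f(x,y)$ be a symmetric real function with property $P^*$. Then the bicyclic graph on $n$ vertices with the second largest value of $\rho(A_f(G))$ is $G_2$, $G_3$ or $G_4$, where (with $K_4^-$ denoting $K_4$ minus an edge, on vertices $x,y,v,w$ with edges $xy,xv,xw,yv,yw$, so $x,y$ have degree $3$ and $v,w$ degree $2$): $G_2$ is obtained from two triangles sharing exactly one vertex $c$ by attaching $n-5$ pendant vertices to $c$; $G_3$ is obtained from $K_4^-$ by attaching $n-4$ pendant vertices to $v$; $G_4$ is obtained from $K_4^-$ by attaching $n-5$ pendant vertices to $x$ and one pendant vertex to $y$.
   Context: All graphs are finite, simple and connected. A bicyclic graph on $n$ vertices is a connected simple graph with $n$ vertices and $n+1$ edges. For a graph $G$ with vertex degrees $d_i$, the weighted adjacency matrix $A_f(G)=[a_{ij}]$ has $a_{ij}=f(d_i,d_j)$ if $ij$ is an edge and $a_{ij}=0$ otherwise, where $f$ is symmetric with $f(d_i,d_j)>0$ for edges $ij$; $\rho(A_f(G))$ is its spectral radius. $f$ has property $P^*$ if (i) $f(x,y)$ is increasing in $x$; (ii) $f(x,y)$ is convex in $x$; (iii) $f(x_1,y_1)\geq f(x_2,y_2)$ whenever $|x_1-y_1|>|x_2-y_2|$ and $x_1+y_1=x_2+y_2$. (The largest value of $\rho(A_f(G))$ among bicyclic graphs on $n$ vertices is attained uniquely by the graph obtained from $K_4^-$ by attaching $n-4$ pendant vertices to $x$.) *)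

theory Defs
  imports
    "HOL-Analysis.Convex"
    "Jordan_Normal_Form.Spectral_Radius"
    "Graph_Theory.Graph_Theory"
begin

text \<open>
  An undirected simple graph is a \<^locale>\<open>pair_graph\<close> (finite, loop-free, symmetric set of arcs);
  every edge is a pair of opposite arcs, so a graph with m edges has 2 * m arcs and the degree of
  a vertex is its out-degree. A graph on n vertices is labelled by 0, ..., n - 1, so that its
  vertices index the rows and columns of a matrix.
\<close>

definition bicyclic :: "nat \<Rightarrow> nat pair_pre_digraph \<Rightarrow> bool" where
  "bicyclic n G \<longleftrightarrow> pair_graph G \<and> pverts G = {0..<n} \<and>
     Digraph_Component.connected (with_proj G) \<and> card (parcs G) = 2 * (n + 1)"

definition deg :: "'a pair_pre_digraph \<Rightarrow> 'a \<Rightarrow> real" where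
  "deg G v = real (out_degree (with_proj G) v)"

definition weighted_adjacency_mat ::
    "(real \<Rightarrow> real \<Rightarrow> real) \<Rightarrow> nat \<Rightarrow> nat pair_pre_digraph \<Rightarrow> complex mat" where
  "weighted_adjacency_mat f n G =
     mat n n (\<lambda>(i, j). if (i, j) \<in> parcs G then complex_of_real (f (deg G i) (deg G j)) else 0)"

definition rho :: "(real \<Rightarrow> real \<Rightarrow> real) \<Rightarrow> nat \<Rightarrow> nat pair_pre_digraph \<Rightarrow> real" where
  "rho f n G = spectral_radius (weighted_adjacency_mat f n G)"

text \<open>
  The weight function is only applied to degrees of non-isolated vertices, so the conditions on it
  are imposed for arguments at least 1. ``Increasing'' is meant in the weak sense.
\<close>

definition symmetric_weight :: "(real \<Rightarrow> real \<Rightarrow> real) \<Rightarrow> bool" where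
  "symmetric_weight f \<longleftrightarrow> (\<forall>x\<ge>1. \<forall>y\<ge>1. f x y = f y x)"

definition property_P_star :: "(real \<Rightarrow> real \<Rightarrow> real) \<Rightarrow> bool" where
  "property_P_star f \<longleftrightarrow>
     (\<forall>y\<ge>1. mono_on {1..} (\<lambda>x. f x y)) \<and>
     (\<forall>y\<ge>1. convex_on {1..} (\<lambda>x. f x y)) \<and>
     (\<forall>x1\<ge>1. \<forall>y1\<ge>1. \<forall>x2\<ge>1. \<forall>y2\<ge>1.
        \<bar>x1 - y1\<bar> > \<bar>x2 - y2\<bar> \<longrightarrow> x1 + y1 = x2 + y2 \<longrightarrow> f x1 y1 \<ge> f x2 y2)"

definition second_largest_in :: "'a::linorder set \<Rightarrow> 'a \<Rightarrow> bool" where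
  "second_largest_in S r \<longleftrightarrow> r \<in> S \<and> card {s \<in> S. r < s} = 1"

definition graph_of_edges :: "nat \<Rightarrow> (nat \<times> nat) set \<Rightarrow> nat pair_pre_digraph" where
  "graph_of_edges m E = \<lparr> pverts = {0..<m}, parcs = E \<union> E\<inverse> \<rparr>"

text \<open>
  Attaching k pendant vertices to the vertex u of a graph with vertices 0, ..., m - 1;
  the new vertices are m, ..., m + k - 1.
\<close>

definition attach_pendants ::
    "nat pair_pre_digraph \<Rightarrow> nat \<Rightarrow> nat \<Rightarrow> nat pair_pre_digraph" where
  "attach_pendants G u k =
     (let m = card (pverts G); P = {m..<m + k} in
      \<lparr> pverts = pverts G \<union> P, parcs = parcs G \<union> {u} \<times> P \<union> P \<times> {u} \<rparr>)"

text \<open>\<open>K\<^sub>4\<close> minus an edge, with \<open>x, y, v, w\<close> being \<open>0, 1, 2, 3\<close>.\<close>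

definition K4_minus :: "nat pair_pre_digraph" where
  "K4_minus = graph_of_edges 4 {(0, 1), (0, 2), (0, 3), (1, 2), (1, 3)}"

definition two_triangles :: "nat pair_pre_digraph" where
  "two_triangles = graph_of_edges 5 {(0, 1), (0, 2), (1, 2), (0, 3), (0, 4), (3, 4)}"

definition G2 :: "nat \<Rightarrow> nat pair_pre_digraph" where
  "G2 n = attach_pendants two_triangles 0 (n - 5)"

definition G3 :: "nat \<Rightarrow> nat pair_pre_digraph" where
  "G3 n = attach_pendants K4_minus 2 (n - 4)"

definition G4 :: "nat \<Rightarrow> nat pair_pre_digraph" where
  "G4 n = attach_pendants (attach_pendants K4_minus 0 (n - 5)) 1 1"

end

theory Submission
  imports Defs "HOL-Analysis.Function_Topology"
begin

text \<open>
  The spectral radius of a symmetric nonnegative matrix is the maximum of its Rayleigh quotient, so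
  moving neighbours of \<open>v\<close> over to a vertex \<open>u\<close> whose Perron entry is at least as large strictly
  increases it: the conditions on the weight make every change of the quadratic form nonnegative.
  As only two vertices are involved, one of the two directions is always available. Moving all
  private neighbours of \<open>v\<close> to \<open>u\<close> creates a dominating vertex only if \<open>u\<close> and \<open>v\<close> are adjacent and
  their neighbourhoods cover all vertices. Hence a graph without dominating vertex that cannot be
  improved within this class has two adjacent vertices covering everything; counting the remaining
  edges leaves \<open>G\<^sub>3\<close> and \<open>K\<^sub>4\<^sup>-\<close> with pendant vertices at both vertices of degree 3, and in the latter
  all but one of the pendant vertices of one centre can be moved to the other, giving \<open>G\<^sub>4\<close>.
  The bicyclic graphs with a dominating vertex are the maximal graph and \<open>G\<^sub>2\<close>.
\<close>

section \<open>Spectral radius of symmetric nonnegative matrices\<close>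

definition sqnorm :: "nat \<Rightarrow> (nat \<Rightarrow> real) \<Rightarrow> real" where
  "sqnorm n x = (\<Sum>i<n. (x i)\<^sup>2)"

definition qform :: "nat \<Rightarrow> (nat \<Rightarrow> nat \<Rightarrow> real) \<Rightarrow> (nat \<Rightarrow> real) \<Rightarrow> real" where
  "qform n W x = (\<Sum>i<n. x i * (\<Sum>j<n. W i j * x j))"

definition spec_rad :: "nat \<Rightarrow> (nat \<Rightarrow> nat \<Rightarrow> real) \<Rightarrow> real" where
  "spec_rad n W = spectral_radius (mat n n (\<lambda>(i, j). complex_of_real (W i j)))"

definition nonneg_sym :: "nat \<Rightarrow> (nat \<Rightarrow> nat \<Rightarrow> real) \<Rightarrow> bool" where
  "nonneg_sym n W \<longleftrightarrow> (\<forall>i<n. \<forall>j<n. W i j = W j i \<and> 0 \<le> W i j)"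

lemma sqnorm_nonneg: "0 \<le> sqnorm n x"
  by (simp add: sqnorm_def sum_nonneg)

lemma sqnorm_pos_iff: "0 < sqnorm n x \<longleftrightarrow> (\<exists>i<n. x i \<noteq> 0)"
proof -
  have "sqnorm n x = 0 \<longleftrightarrow> (\<forall>i<n. x i = 0)"
    unfolding sqnorm_def by (subst sum_nonneg_eq_0_iff) auto
  then show ?thesis
    using sqnorm_nonneg[of n x] by (metis less_le)
qed

lemma rayleigh_max_exists:
  assumes "n > 0"
  shows "\<exists>x. sqnorm n x = 1 \<and> (\<forall>y. sqnorm n y = 1 \<longrightarrow> qform n W y \<le> qform n W x)"
proof -
  define B :: "nat \<Rightarrow> real set" where "B = (\<lambda>i. if i < n then {-1..1} else {0})"
  define K where "K = PiE UNIV B \<inter> {x. sqnorm n x = 1}"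
  have coord: "continuous_on UNIV (\<lambda>x::nat \<Rightarrow> real. x i)" for i
    by (rule continuous_on_product_coordinates)
  have "compactin (product_topology (\<lambda>i. euclidean) UNIV) (PiE UNIV B)"
    unfolding compactin_PiE by (auto simp: B_def)
  then have "compact (PiE UNIV B)"
    by (simp add: euclidean_product_topology)
  moreover have "continuous_on UNIV (sqnorm n)"
    unfolding sqnorm_def by (intro continuous_intros coord)
  then have "closed {x. sqnorm n x = 1}"
    by (intro closed_Collect_eq continuous_on_const)
  ultimately have "compact K"
    unfolding K_def by (rule compact_Int_closed)
  moreover have "sqnorm n (\<lambda>i. if i = 0 then 1 else 0) = 1"
    using assms by (simp add: sqnorm_def sum.remove[of "{..<n}" 0])
  then have "(\<lambda>i. if i = 0 then 1 else 0) \<in> K"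
    using assms by (auto simp: K_def B_def PiE_def)
  then have "K \<noteq> {}"
    by blast
  moreover have "continuous_on K (qform n W)"
    unfolding qform_def by (intro continuous_intros continuous_on_subset[OF coord]) auto
  ultimately obtain x where x: "x \<in> K" "\<And>y. y \<in> K \<Longrightarrow> qform n W y \<le> qform n W x"
    using continuous_attains_sup by metis
  have "qform n W y \<le> qform n W x" if y: "sqnorm n y = 1" for y
  proof -
    define z where "z = (\<lambda>i. if i < n then y i else 0)"
    have "sqnorm n z = 1" "qform n W z = qform n W y"
      using y by (simp_all add: z_def sqnorm_def qform_def)
    moreover have "\<bar>y i\<bar> \<le> 1" if "i < n" for i
    proof -
      have "(y i)\<^sup>2 \<le> sqnorm n y"
        unfolding sqnorm_def using that by (intro member_le_sum) auto
      then show ?thesis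
        using y by (simp add: abs_square_le_1)
    qed
    then have "z \<in> PiE UNIV B"
      by (auto simp: z_def B_def PiE_def abs_le_iff)
    ultimately show ?thesis
      using x(2)[of z] by (simp add: K_def)
  qed
  then show ?thesis
    using x(1) by (auto simp: K_def)
qed

lemma rayleigh_scale:
  assumes "\<And>y. sqnorm n y = 1 \<Longrightarrow> qform n W y \<le> M"
  shows "qform n W y \<le> M * sqnorm n y"
proof (cases "sqnorm n y = 0")
  case True
  then have "\<forall>i<n. y i = 0"
    using sqnorm_pos_iff[of n y] by auto
  then show ?thesis
    using True by (simp add: qform_def)
next
  case False
  define c where "c = sqrt (sqnorm n y)"
  have c: "c > 0" "c\<^sup>2 = sqnorm n y"
    using False sqnorm_nonneg[of n y] by (auto simp: c_def)
  have "sqnorm n (\<lambda>i. y i / c) = sqnorm n y / c\<^sup>2"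
    by (simp add: sqnorm_def power_divide sum_divide_distrib)
  moreover have "qform n W (\<lambda>i. y i / c) = qform n W y / c\<^sup>2"
    by (simp add: qform_def sum_divide_distrib power2_eq_square sum_distrib_left)
  ultimately have "qform n W y / c\<^sup>2 \<le> M"
    using assms[of "\<lambda>i. y i / c"] c False by simp
  then show ?thesis
    using c(1) unfolding c(2)[symmetric] by (simp add: pos_divide_le_eq)
qed

lemma qform_add_unit:
  assumes sym: "\<And>i j. i < n \<Longrightarrow> j < n \<Longrightarrow> W i j = W j i" and k: "k < n"
  shows "qform n W (x(k := x k + t)) =
    qform n W x + 2 * t * (\<Sum>j<n. W k j * x j) + t\<^sup>2 * W k k"
proof -
  define e where "e = (\<lambda>i. if i = k then t else 0)"
  have x: "x(k := x k + t) = (\<lambda>i. x i + e i)"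
    by (auto simp: e_def)
  have e: "(\<Sum>j<n. a j * e j) = a k * t" for a
    using k by (simp add: e_def if_distrib cong: if_cong)
  have e': "(\<Sum>i<n. e i * a i) = t * a k" for a
    using e[of a] by (simp add: mult.commute)
  have "(\<Sum>i<n. x i * (W i k * t)) = (\<Sum>i<n. t * (W k i * x i))"
    using sym k by (intro sum.cong) auto
  then have cross: "(\<Sum>i<n. x i * (W i k * t)) = t * (\<Sum>j<n. W k j * x j)"
    by (simp add: sum_distrib_left)
  have row: "(\<Sum>j<n. W i j * (x j + e j)) = (\<Sum>j<n. W i j * x j) + W i k * t" for i
    by (simp add: distrib_left sum.distrib e)
  have "qform n W (\<lambda>i. x i + e i) =
      (\<Sum>i<n. x i * (\<Sum>j<n. W i j * x j)) + (\<Sum>i<n. x i * (W i k * t)) +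
      ((\<Sum>i<n. e i * (\<Sum>j<n. W i j * x j)) + (\<Sum>i<n. e i * (W i k * t)))"
    unfolding qform_def row by (simp only: distrib_left distrib_right sum.distrib ac_simps)
  then show ?thesis
    unfolding x cross e' qform_def by (simp add: power2_eq_square)
qed

lemma sqnorm_add_unit:
  assumes k: "k < n"
  shows "sqnorm n (x(k := x k + t)) = sqnorm n x + 2 * t * x k + t\<^sup>2"
proof -
  have "sqnorm n (x(k := x k + t)) = (x k + t)\<^sup>2 + (\<Sum>i\<in>{..<n} - {k}. (x i)\<^sup>2)"
    using k by (simp add: sqnorm_def sum.remove[of "{..<n}" k])
  moreover have "sqnorm n x = (x k)\<^sup>2 + (\<Sum>i\<in>{..<n} - {k}. (x i)\<^sup>2)"
    using k by (simp add: sqnorm_def sum.remove[of "{..<n}" k])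
  ultimately show ?thesis
    by (simp add: power2_sum)
qed

lemma linear_coeff_zero:
  fixes b c :: real
  assumes "\<And>t. t * b + t\<^sup>2 * c \<le> 0"
  shows "b = 0"
proof (rule ccontr)
  assume "b \<noteq> 0"
  define d where "d = \<bar>c\<bar> + 1"
  have d: "d > 0" "c > - d"
    by (auto simp: d_def)
  have "b / d * b + (b / d)\<^sup>2 * c \<le> 0"
    by (rule assms)
  then have "b\<^sup>2 * (d + c) / d\<^sup>2 \<le> 0"
    using d(1) by (simp add: field_simps power2_eq_square)
  moreover have "b\<^sup>2 * (d + c) / d\<^sup>2 > 0"
    using d \<open>b \<noteq> 0\<close> by simp
  ultimately show False
    by simp
qed

lemma rayleigh_equality_eigenvector:
  assumes sym: "\<And>i j. i < n \<Longrightarrow> j < n \<Longrightarrow> W i j = W j i"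
    and bound: "\<And>y. qform n W y \<le> M * sqnorm n y"
    and eq: "qform n W x = M * sqnorm n x"
    and k: "k < n"
  shows "(\<Sum>j<n. W k j * x j) = M * x k"
proof -
  have "t * (2 * ((\<Sum>j<n. W k j * x j) - M * x k)) + t\<^sup>2 * (W k k - M) \<le> 0" for t
  proof -
    have "qform n W (x(k := x k + t)) =
        qform n W x + 2 * t * (\<Sum>j<n. W k j * x j) + t\<^sup>2 * W k k"
      using sym k by (rule qform_add_unit)
    then show ?thesis
      using bound[of "x(k := x k + t)"] eq unfolding sqnorm_add_unit[OF k] by (simp add: algebra_simps)
  qed
  from linear_coeff_zero[OF this] show ?thesis
    by simp
qed

lemma eigenvector_fun_iff:
  fixes W :: "nat \<Rightarrow> nat \<Rightarrow> 'a::field"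
  shows "eigenvalue (mat n n (\<lambda>(i, j). W i j)) c \<longleftrightarrow>
    (\<exists>z. (\<exists>i<n. z i \<noteq> 0) \<and> (\<forall>i<n. (\<Sum>j<n. W i j * z j) = c * z i))"
proof
  assume "eigenvalue (mat n n (\<lambda>(i, j). W i j)) c"
  then obtain v where v: "v \<in> carrier_vec n" "v \<noteq> 0\<^sub>v n"
    "mat n n (\<lambda>(i, j). W i j) *\<^sub>v v = c \<cdot>\<^sub>v v"
    unfolding eigenvalue_def eigenvector_def by auto
  have "\<exists>i<n. v $ i \<noteq> 0"
    using v(1,2) by (metis eq_vecI carrier_vecD index_zero_vec)
  moreover have "(\<Sum>j<n. W i j * v $ j) = c * v $ i" if "i < n" for i
  proof -
    have "(mat n n (\<lambda>(i, j). W i j) *\<^sub>v v) $ i = (\<Sum>j<n. W i j * v $ j)"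
      using that v(1) by (simp add: scalar_prod_def atLeast0LessThan)
    then show ?thesis
      using v(1,3) that by simp
  qed
  ultimately show "\<exists>z. (\<exists>i<n. z i \<noteq> 0) \<and> (\<forall>i<n. (\<Sum>j<n. W i j * z j) = c * z i)"
    by blast
next
  assume "\<exists>z. (\<exists>i<n. z i \<noteq> 0) \<and> (\<forall>i<n. (\<Sum>j<n. W i j * z j) = c * z i)"
  then obtain z where z: "\<exists>i<n. z i \<noteq> 0" "\<And>i. i < n \<Longrightarrow> (\<Sum>j<n. W i j * z j) = c * z i"
    by blast
  have "vec n z \<noteq> 0\<^sub>v n"
    using z(1) by (metis index_vec index_zero_vec(1))
  moreover have "mat n n (\<lambda>(i, j). W i j) *\<^sub>v vec n z = c \<cdot>\<^sub>v vec n z"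
    using z(2) by (intro eq_vecI) (auto simp: scalar_prod_def atLeast0LessThan)
  ultimately show "eigenvalue (mat n n (\<lambda>(i, j). W i j)) c"
    unfolding eigenvalue_def eigenvector_def by (intro exI[of _ "vec n z"]) auto
qed

lemma eigenvalue_norm_le:
  assumes nonneg: "\<And>i j. i < n \<Longrightarrow> j < n \<Longrightarrow> 0 \<le> W i j"
    and bound: "\<And>y. qform n W y \<le> M * sqnorm n y"
    and ev: "eigenvalue (mat n n (\<lambda>(i, j). complex_of_real (W i j))) c"
  shows "cmod c \<le> M"
proof -
  from ev obtain z where z: "\<exists>i<n. z i \<noteq> 0"
    "\<And>i. i < n \<Longrightarrow> (\<Sum>j<n. complex_of_real (W i j) * z j) = c * z i"
    using eigenvector_fun_iff[of n "\<lambda>i j. complex_of_real (W i j)"] by auto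
  define y where "y = (\<lambda>i. cmod (z i))"
  have "cmod c * y i \<le> (\<Sum>j<n. W i j * y j)" if "i < n" for i
  proof -
    have "cmod c * y i = cmod (\<Sum>j<n. complex_of_real (W i j) * z j)"
      using z(2)[OF that] by (simp add: y_def norm_mult)
    also have "\<dots> \<le> (\<Sum>j<n. cmod (complex_of_real (W i j) * z j))"
      by (rule norm_sum)
    also have "\<dots> = (\<Sum>j<n. W i j * y j)"
      using that nonneg by (intro sum.cong) (auto simp: y_def norm_mult)
    finally show ?thesis .
  qed
  then have "(\<Sum>i<n. y i * (cmod c * y i)) \<le> qform n W y"
    unfolding qform_def by (intro sum_mono mult_left_mono) (auto simp: y_def)
  then have "cmod c * sqnorm n y \<le> M * sqnorm n y"
    using bound[of y] by (simp add: sqnorm_def sum_distrib_left power2_eq_square mult.left_commute)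
  moreover have "sqnorm n y > 0"
    using z(1) by (auto simp: sqnorm_pos_iff y_def)
  ultimately show ?thesis
    by simp
qed

lemma qform_abs:
  assumes "\<And>i j. i < n \<Longrightarrow> j < n \<Longrightarrow> 0 \<le> W i j"
  shows "qform n W x \<le> qform n W (\<lambda>i. \<bar>x i\<bar>)"
  unfolding qform_def sum_distrib_left
proof (intro sum_mono)
  fix i j assume "i \<in> {..<n}" "j \<in> {..<n}"
  then have "W i j * (x i * x j) \<le> W i j * (\<bar>x i\<bar> * \<bar>x j\<bar>)"
    using assms abs_ge_self[of "x i * x j"] by (intro mult_left_mono) (auto simp: abs_mult)
  then show "x i * (W i j * x j) \<le> \<bar>x i\<bar> * (W i j * \<bar>x j\<bar>)"
    by (simp add: algebra_simps)
qed

lemma spec_rad_rayleigh: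
  assumes n: "n > 0"
    and W: "nonneg_sym n W"
  shows "\<exists>x. sqnorm n x = 1 \<and> (\<forall>i. 0 \<le> x i) \<and> qform n W x = spec_rad n W"
    and "qform n W y \<le> spec_rad n W * sqnorm n y"
proof -
  have sym: "W i j = W j i" and nonneg: "0 \<le> W i j" if "i < n" "j < n" for i j
    using W that by (auto simp: nonneg_sym_def)
  let ?A = "mat n n (\<lambda>(i, j). complex_of_real (W i j))"
  obtain x0 where x0: "sqnorm n x0 = 1" "\<And>y. sqnorm n y = 1 \<Longrightarrow> qform n W y \<le> qform n W x0"
    using rayleigh_max_exists[OF n] by blast
  define x where "x = (\<lambda>i. \<bar>x0 i\<bar>)"
  define M where "M = qform n W x"
  have x: "sqnorm n x = 1" "\<And>i. 0 \<le> x i"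
    using x0(1) by (auto simp: x_def sqnorm_def)
  have bound: "qform n W y \<le> M * sqnorm n y" for y
  proof (rule rayleigh_scale)
    fix y assume "sqnorm n y = 1"
    then show "qform n W y \<le> M"
      using x0(2)[of y] qform_abs[of n W x0] nonneg by (simp add: M_def x_def)
  qed
  have "(\<Sum>j<n. W i j * x j) = M * x i" if "i < n" for i
    using sym bound _ that by (rule rayleigh_equality_eigenvector) (simp_all add: M_def x(1))
  then have eq: "(\<Sum>j<n. complex_of_real (W i j) * complex_of_real (x j)) =
      complex_of_real M * complex_of_real (x i)" if "i < n" for i
    using that by (metis (mono_tags, lifting) of_real_mult of_real_sum sum.cong)
  moreover have "\<exists>i<n. x i \<noteq> 0"
    using x(1) sqnorm_pos_iff[of n x] by simp
  ultimately have ev: "eigenvalue ?A (complex_of_real M)"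
    unfolding eigenvector_fun_iff[of n "\<lambda>i j. complex_of_real (W i j)"]
    by (intro exI[of _ "\<lambda>i. complex_of_real (x i)"]) simp
  have A: "?A \<in> carrier_mat n n"
    by simp
  have "spec_rad n W \<in> cmod ` spectrum ?A"
    unfolding spec_rad_def by (rule spectral_radius_mem_max(1)[OF A n])
  then have "spec_rad n W \<le> M"
    using eigenvalue_norm_le[OF nonneg bound] by (auto simp: spectrum_def)
  moreover have "cmod (complex_of_real M) \<le> spec_rad n W"
    unfolding spec_rad_def using ev
    by (intro spectral_radius_mem_max(2)[OF A n] imageI) (simp add: spectrum_def)
  ultimately have "spec_rad n W = M"
    by simp
  then show "\<exists>x. sqnorm n x = 1 \<and> (\<forall>i. 0 \<le> x i) \<and> qform n W x = spec_rad n W"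
    "qform n W y \<le> spec_rad n W * sqnorm n y"
    using x bound by (auto simp: M_def)
qed

lemma perron_vector:
  assumes n: "n > 0"
    and W: "nonneg_sym n W"
    and E: "\<And>i j. (i, j) \<in> E \<Longrightarrow> i < n \<and> j < n \<and> 0 < W i j"
    and conn: "\<And>i j. i < n \<Longrightarrow> j < n \<Longrightarrow> (i, j) \<in> E\<^sup>*"
  obtains x where "sqnorm n x = 1" "\<And>i. i < n \<Longrightarrow> 0 < x i"
    "\<And>i. i < n \<Longrightarrow> (\<Sum>j<n. W i j * x j) = spec_rad n W * x i"
    "qform n W x = spec_rad n W"
proof -
  have sym: "W i j = W j i" and nonneg: "0 \<le> W i j" if "i < n" "j < n" for i j
    using W that by (auto simp: nonneg_sym_def)
  obtain x where x: "sqnorm n x = 1" "\<And>i. 0 \<le> x i" "qform n W x = spec_rad n W"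
    using spec_rad_rayleigh(1)[OF n W] by blast
  have eig: "(\<Sum>j<n. W i j * x j) = spec_rad n W * x i" if "i < n" for i
    using sym spec_rad_rayleigh(2)[OF n W] _ that
    by (rule rayleigh_equality_eigenvector) (simp_all add: x)
  have zero: "x j = 0" if "(i, j) \<in> E" "x i = 0" for i j
  proof -
    have ij: "i < n" "j < n" "0 < W i j"
      using E that(1) by auto
    have "(\<Sum>j<n. W i j * x j) = 0"
      using eig[OF ij(1)] that(2) by simp
    then have "\<forall>j\<in>{..<n}. W i j * x j = 0"
      using nonneg ij(1) x(2) by (subst (asm) sum_nonneg_eq_0_iff) auto
    then show ?thesis
      using ij by (metis lessThan_iff less_irrefl mult_eq_0_iff)
  qed
  have "0 < x i" if "i < n" for i
  proof (rule ccontr)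
    assume "\<not> 0 < x i"
    then have "x i = 0"
      using x(2)[of i] by simp
    have "x j = 0" if "(i, j) \<in> E\<^sup>*" for j
      using that \<open>x i = 0\<close> by induction (auto dest: zero)
    then have "\<forall>j<n. x j = 0"
      using conn that by blast
    then show False
      using x(1) sqnorm_pos_iff[of n x] by auto
  qed
  then show thesis
    using that x eig by blast
qed

lemma spec_rad_strict_mono:
  assumes n: "n > 0"
    and W: "nonneg_sym n W"
    and x: "sqnorm n x = 1" "r \<le> qform n W x"
    and u: "u < n" "r * x u < (\<Sum>j<n. W u j * x j)"
  shows "r < spec_rad n W"
proof (rule ccontr)
  note bound = spec_rad_rayleigh(2)[OF n W]
  assume "\<not> r < spec_rad n W"
  then have r: "r = spec_rad n W" "qform n W x = spec_rad n W"
    using x bound[of x] by auto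
  have sym: "W i j = W j i" if "i < n" "j < n" for i j
    using W that by (auto simp: nonneg_sym_def)
  have "(\<Sum>j<n. W u j * x j) = spec_rad n W * x u"
    using sym bound _ u(1) by (rule rayleigh_equality_eigenvector) (simp_all add: r x)
  then show False
    using u(2) r by simp
qed

lemma spec_rad_permute:
  assumes p: "bij_betw p {..<n} {..<n}"
    and W: "\<And>i j. i < n \<Longrightarrow> j < n \<Longrightarrow> W' (p i) (p j) = W i j"
  shows "spec_rad n W' = spec_rad n W"
proof -
  have "eigenvalue (mat n n (\<lambda>(i, j). complex_of_real (W' i j))) c \<longleftrightarrow>
        eigenvalue (mat n n (\<lambda>(i, j). complex_of_real (W i j))) c" (is "?L \<longleftrightarrow> ?R") for c
  proof
    have pn: "p i < n" if "i < n" for i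
      using p that by (auto simp: bij_betw_def)
    have surj: "\<exists>i<n. j = p i" if "j < n" for j
      using p that by (metis bij_betw_iff_bijections lessThan_iff)
    have sum_p: "(\<Sum>j<n. g (p j)) = (\<Sum>j<n. g j)" for g :: "nat \<Rightarrow> complex"
      by (rule sum.reindex_bij_betw[OF p])
    {
      assume ?L
      then obtain z where z: "\<exists>i<n. z i \<noteq> 0"
        "\<And>i. i < n \<Longrightarrow> (\<Sum>j<n. complex_of_real (W' i j) * z j) = c * z i"
        using eigenvector_fun_iff[of n "\<lambda>i j. complex_of_real (W' i j)"] by auto
      have "(\<Sum>j<n. complex_of_real (W i j) * z (p j)) = c * z (p i)" if "i < n" for i
      proof -
        have "(\<Sum>j<n. complex_of_real (W i j) * z (p j)) =
            (\<Sum>j<n. complex_of_real (W' (p i) (p j)) * z (p j))"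
          using that by (simp add: W)
        also have "\<dots> = (\<Sum>j<n. complex_of_real (W' (p i) j) * z j)"
          by (rule sum_p)
        finally show ?thesis
          using z(2)[OF pn[OF that]] by simp
      qed
      moreover have "\<exists>i<n. z (p i) \<noteq> 0"
        using z(1) surj by metis
      ultimately show ?R
        unfolding eigenvector_fun_iff[of n "\<lambda>i j. complex_of_real (W i j)"]
        by (intro exI[of _ "\<lambda>i. z (p i)"]) simp
    }
    {
      assume ?R
      then obtain z where z: "\<exists>i<n. z i \<noteq> 0"
        "\<And>i. i < n \<Longrightarrow> (\<Sum>j<n. complex_of_real (W i j) * z j) = c * z i"
        using eigenvector_fun_iff[of n "\<lambda>i j. complex_of_real (W i j)"] by auto
      define y where "y = (\<lambda>j. z (the_inv_into {..<n} p j))"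
      have y: "y (p i) = z i" if "i < n" for i
        using p that by (auto simp: y_def bij_betw_def the_inv_into_f_f)
      have "(\<Sum>j<n. complex_of_real (W' i j) * y j) = c * y i" if "i < n" for i
      proof -
        obtain k where k: "k < n" "i = p k"
          using surj[of i] \<open>i < n\<close> by blast
        have "(\<Sum>j<n. complex_of_real (W' i j) * y j) =
            (\<Sum>j<n. complex_of_real (W' i (p j)) * y (p j))"
          by (rule sum_p[symmetric])
        also have "\<dots> = (\<Sum>j<n. complex_of_real (W k j) * z j)"
          using k by (simp add: y W)
        finally show ?thesis
          using z(2)[OF k(1)] k y by simp
      qed
      moreover have "\<exists>i<n. y i \<noteq> 0"
        using z(1) y pn by metis
      ultimately show ?L
        unfolding eigenvector_fun_iff[of n "\<lambda>i j. complex_of_real (W' i j)"]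
        by (intro exI[of _ y]) simp
    }
  qed
  then have "spectrum (mat n n (\<lambda>(i, j). complex_of_real (W' i j))) =
      spectrum (mat n n (\<lambda>(i, j). complex_of_real (W i j)))"
    unfolding spectrum_def by blast
  then show ?thesis
    by (simp add: spec_rad_def spectral_radius_def)
qed

section \<open>Moving neighbours from one vertex to another\<close>

abbreviation nb :: "(nat \<times> nat) set \<Rightarrow> nat \<Rightarrow> nat set" where
  "nb E v \<equiv> E `` {v}"

abbreviation dg :: "(nat \<times> nat) set \<Rightarrow> nat \<Rightarrow> nat" where
  "dg E v \<equiv> card (nb E v)"

definition bicyclic_arcs :: "nat \<Rightarrow> (nat \<times> nat) set \<Rightarrow> bool" where
  "bicyclic_arcs n E \<longleftrightarrow> E \<subseteq> {..<n} \<times> {..<n} \<and> sym E \<and> irrefl E \<and>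
     (\<forall>i<n. \<forall>j<n. (i, j) \<in> E\<^sup>*) \<and> card E = 2 * (n + 1)"

definition edge_weight :: "(real \<Rightarrow> real \<Rightarrow> real) \<Rightarrow> (nat \<times> nat) set \<Rightarrow> nat \<Rightarrow> nat \<Rightarrow> real" where
  "edge_weight f E i j = (if (i, j) \<in> E then f (real (dg E i)) (real (dg E j)) else 0)"

definition shift :: "(nat \<times> nat) set \<Rightarrow> nat \<Rightarrow> nat \<Rightarrow> nat set \<Rightarrow> (nat \<times> nat) set" where
  "shift E u v S = (E - ({v} \<times> S \<union> S \<times> {v})) \<union> ({u} \<times> S \<union> S \<times> {u})"

lemma bicyclic_arcsD:
  assumes "bicyclic_arcs n E"
  shows "(i, j) \<in> E \<Longrightarrow> i < n" "(i, j) \<in> E \<Longrightarrow> j < n" "(i, j) \<in> E \<Longrightarrow> (j, i) \<in> E"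
    "(i, i) \<notin> E" "i < n \<Longrightarrow> j < n \<Longrightarrow> (i, j) \<in> E\<^sup>*" "card E = 2 * (n + 1)"
    "finite E" "finite (nb E i)"
proof -
  have "E \<subseteq> {..<n} \<times> {..<n}"
    using assms by (simp add: bicyclic_arcs_def)
  then show "finite E"
    by (rule finite_subset) simp
  then show "finite (nb E i)"
    by (rule finite_Image)
qed (use assms in \<open>auto simp: bicyclic_arcs_def irrefl_def dest: symD\<close>)

lemma dg_pos:
  assumes "bicyclic_arcs n E" "(i, j) \<in> E"
  shows "1 \<le> dg E i"
proof -
  have "dg E i > 0"
    using assms bicyclic_arcsD(8)[OF assms(1)] by (subst card_gt_0_iff) auto
  then show ?thesis
    by simp
qed

locale shift_setup =
  fixes n :: nat and E :: "(nat \<times> nat) set" and u v :: nat and S :: "nat set"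
  assumes bic: "bicyclic_arcs n E"
    and uv: "u \<noteq> v" "u < n" "v < n"
    and S: "S \<subseteq> nb E v" "S \<inter> nb E u = {}" "u \<notin> S" "S \<noteq> {}"
begin

abbreviation "E' \<equiv> shift E u v S"

lemma v_notin: "v \<notin> S"
  using S bicyclic_arcsD(4)[OF bic] by auto

lemma finite_S: "finite S"
  using S(1) bicyclic_arcsD(8)[OF bic] by (rule finite_subset)

lemma nb_u: "nb E' u = nb E u \<union> S"
  using uv S v_notin by (auto simp: shift_def)

lemma nb_v: "nb E' v = nb E v - S"
  using uv S v_notin by (auto simp: shift_def)

lemma nb_S: "s \<in> S \<Longrightarrow> nb E' s = insert u (nb E s - {v})"
  using uv S v_notin by (auto simp: shift_def)

lemma nb_other: "i \<noteq> u \<Longrightarrow> i \<noteq> v \<Longrightarrow> i \<notin> S \<Longrightarrow> nb E' i = nb E i"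
  by (auto simp: shift_def)

lemma dg_u: "dg E' u = dg E u + card S"
  unfolding nb_u using S(2) finite_S bicyclic_arcsD(8)[OF bic] by (subst card_Un_disjoint) auto

lemma dg_v: "dg E' v = dg E v - card S"
  unfolding nb_v using S(1) finite_S by (rule card_Diff_subset[rotated])

lemma dg_other:
  assumes "i \<noteq> u" "i \<noteq> v"
  shows "dg E' i = dg E i"
proof (cases "i \<in> S")
  case True
  have "v \<in> nb E i"
    using True S(1) bicyclic_arcsD(3)[OF bic] by auto
  moreover have "u \<notin> nb E i"
    using True S(2) bicyclic_arcsD(3)[OF bic] by auto
  moreover have "finite (nb E i)"
    by (rule bicyclic_arcsD(8)[OF bic])
  moreover have "0 < dg E i"
    using calculation by (auto simp: card_gt_0_iff)
  ultimately show ?thesis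
    unfolding nb_S[OF True] by simp
qed (use assms nb_other in simp)

lemma sym_shift: "(i, j) \<in> E' \<Longrightarrow> (j, i) \<in> E'"
  using bicyclic_arcsD(3)[OF bic] by (auto simp: shift_def)

lemma shift_bicyclic_arcs:
  assumes "(u, v) \<in> E \<or> (\<exists>w. (u, w) \<in> E \<and> (v, w) \<in> E)"
  shows "bicyclic_arcs n E'"
proof -
  note B = bicyclic_arcsD[OF bic]
  have "(v, u) \<in> E'\<^sup>*"
    using assms
  proof
    assume "(u, v) \<in> E"
    then have "(v, u) \<in> E'"
      using S(3) v_notin B(3) by (auto simp: shift_def)
    then show ?thesis ..
  next
    assume "\<exists>w. (u, w) \<in> E \<and> (v, w) \<in> E"
    then obtain w where w: "(u, w) \<in> E" "(v, w) \<in> E"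
      by blast
    then have "w \<notin> S" "w \<noteq> u"
      using S B(4) by auto
    then have "(v, w) \<in> E'" "(w, u) \<in> E'"
      using w B(3) v_notin uv S by (auto simp: shift_def)
    then show ?thesis
      by (meson r_into_rtrancl rtrancl.rtrancl_into_rtrancl)
  qed
  moreover have sym: "sym E'"
    using sym_shift by (auto simp: sym_def)
  ultimately have vu: "(v, u) \<in> E'\<^sup>*" "(u, v) \<in> E'\<^sup>*"
    by (auto dest: symD[OF sym_rtrancl])
  have "(i, j) \<in> E'\<^sup>*" if ij: "(i, j) \<in> E" for i j
  proof (cases "(i, j) \<in> E'")
    case False
    then consider "i = v" "j \<in> S" | "j = v" "i \<in> S"
      using ij by (auto simp: shift_def)
    then show ?thesis
    proof cases
      case 1
      then have "(u, j) \<in> E'"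
        by (simp add: shift_def)
      then show ?thesis
        using vu(1) 1 by (simp add: rtrancl.rtrancl_into_rtrancl)
    next
      case 2
      then have "(i, u) \<in> E'"
        by (simp add: shift_def)
      then show ?thesis
        using vu(2) 2 by (simp add: converse_rtrancl_into_rtrancl)
    qed
  qed auto
  then have "E\<^sup>* \<subseteq> E'\<^sup>*"
    by (intro rtrancl_subset_rtrancl) auto
  then have conn: "\<forall>i<n. \<forall>j<n. (i, j) \<in> E'\<^sup>*"
    using B(5) by blast
  have "S \<subseteq> {..<n}"
    using S(1) B(2) by auto
  then have sub: "E' \<subseteq> {..<n} \<times> {..<n}"
    using uv B(1,2) by (auto simp: shift_def)
  have irr: "irrefl E'"
    using B(4) S(3) by (auto simp: shift_def irrefl_def)
  have two: "card ({w} \<times> S \<union> S \<times> {w}) = 2 * card S" if "w \<notin> S" for w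
    using that finite_S by (subst card_Un_disjoint) auto
  have old: "{v} \<times> S \<union> S \<times> {v} \<subseteq> E"
    using S(1) B(3) by auto
  have new: "({u} \<times> S \<union> S \<times> {u}) \<inter> E = {}"
    using S(2) B(3) by auto
  have fin: "finite ({v} \<times> S \<union> S \<times> {v})" "finite ({u} \<times> S \<union> S \<times> {u})"
    using finite_S by auto
  have "card E' = card (E - ({v} \<times> S \<union> S \<times> {v})) + card ({u} \<times> S \<union> S \<times> {u})"
    unfolding shift_def using new fin B(7) by (intro card_Un_disjoint) auto
  also have "\<dots> = card E - 2 * card S + 2 * card S"
    unfolding two[OF S(3)] card_Diff_subset[OF fin(1) old] two[OF v_notin] ..
  also have "\<dots> = card E"
    using card_mono[OF B(7) old] unfolding two[OF v_notin] by simp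
  finally show ?thesis
    using sub sym irr conn B(6) by (simp add: bicyclic_arcs_def)
qed

end

lemma qform_two_rows:
  assumes sym: "\<And>i j. i < n \<Longrightarrow> j < n \<Longrightarrow> D i j = D j i"
    and uv: "u < n" "v < n" "u \<noteq> v"
    and zero: "\<And>i j. i \<notin> {u, v} \<Longrightarrow> j \<notin> {u, v} \<Longrightarrow> D i j = 0"
    and diag: "D u u = 0" "D v v = 0"
  shows "qform n D x =
    2 * (\<Sum>j\<in>{..<n} - {u, v}. x j * (D u j * x u + D v j * x v)) + 2 * (D u v * x u * x v)"
proof -
  let ?R = "{..<n} - {u, v}"
  have split: "(\<Sum>i<n. g i) = g u + g v + sum g ?R" for g :: "nat \<Rightarrow> real"
    using uv by (simp add: sum.remove[of "{..<n}" u] sum.remove[of "{..<n} - {u}" v]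
        Diff_insert2[symmetric] add.assoc insert_commute)
  have "(\<Sum>j<n. D i j * x j) = D u i * x u + D v i * x v" if "i \<in> ?R" for i
    using that uv sym[of i u] sym[of i v] zero[of i] unfolding split by simp
  then have rest: "(\<Sum>i\<in>?R. x i * (\<Sum>j<n. D i j * x j)) =
      (\<Sum>i\<in>?R. x i * (D u i * x u + D v i * x v))"
    by simp
  have "qform n D x = x u * (\<Sum>j<n. D u j * x j) + x v * (\<Sum>j<n. D v j * x j) +
      (\<Sum>i\<in>?R. x i * (\<Sum>j<n. D i j * x j))"
    unfolding qform_def by (rule split)
  also have "\<dots> = x u * (D u v * x v + (\<Sum>j\<in>?R. D u j * x j)) +
      x v * (D v u * x u + (\<Sum>j\<in>?R. D v j * x j)) +
      (\<Sum>j\<in>?R. x j * (D u j * x u + D v j * x v))"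
    unfolding rest by (simp add: split diag)
  finally have "qform n D x = x u * (D u v * x v + (\<Sum>j\<in>?R. D u j * x j)) +
      x v * (D v u * x u + (\<Sum>j\<in>?R. D v j * x j)) +
      (\<Sum>j\<in>?R. x j * (D u j * x u + D v j * x v))" .
  moreover have "x u * (\<Sum>j\<in>?R. D u j * x j) + x v * (\<Sum>j\<in>?R. D v j * x j) =
      (\<Sum>j\<in>?R. x j * (D u j * x u + D v j * x v))"
    by (simp add: sum_distrib_left sum.distrib distrib_left ac_simps)
  moreover have "D v u = D u v"
    using sym uv by simp
  ultimately show ?thesis
    by (simp add: algebra_simps)
qed

lemma qform_diff: "qform n (\<lambda>i j. W' i j - W i j) x = qform n W' x - qform n W x"
  by (simp add: qform_def left_diff_distrib sum_subtractf right_diff_distrib)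

locale bicyclic_weight =
  fixes n :: nat and f :: "real \<Rightarrow> real \<Rightarrow> real"
  assumes n: "n > 0"
    and weight_sym: "symmetric_weight f"
    and weight_P: "property_P_star f"
    and weight_pos: "\<And>E i j. bicyclic_arcs n E \<Longrightarrow> (i, j) \<in> E \<Longrightarrow> 0 < f (real (dg E i)) (real (dg E j))"
begin

abbreviation R :: "(nat \<times> nat) set \<Rightarrow> real" where
  "R E \<equiv> spec_rad n (edge_weight f E)"

lemma f_sym: "1 \<le> x \<Longrightarrow> 1 \<le> y \<Longrightarrow> f x y = f y x"
  using weight_sym by (simp add: symmetric_weight_def)

lemma f_mono: "1 \<le> x \<Longrightarrow> x \<le> x' \<Longrightarrow> 1 \<le> y \<Longrightarrow> f x y \<le> f x' y"
  using weight_P by (auto simp: property_P_star_def mono_on_def)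

lemma f_convex: "1 \<le> y \<Longrightarrow> convex_on {1..} (\<lambda>x. f x y)"
  using weight_P by (simp add: property_P_star_def)

lemma f_balance:
  assumes "1 \<le> x1" "1 \<le> y1" "1 \<le> x2" "1 \<le> y2" "x1 + y1 = x2 + y2" "\<bar>x2 - y2\<bar> \<le> \<bar>x1 - y1\<bar>"
  shows "f x2 y2 \<le> f x1 y1"
proof (cases "\<bar>x2 - y2\<bar> < \<bar>x1 - y1\<bar>")
  case True
  then show ?thesis
    using weight_P assms by (auto simp: property_P_star_def)
next
  case False
  then have "x1 = x2 \<and> y1 = y2 \<or> x1 = y2 \<and> y1 = x2"
    using assms by linarith
  then show ?thesis
    using f_sym assms by auto
qed

lemma f_increment:
  assumes "1 \<le> a" "a \<le> b" "0 \<le> h" "1 \<le> y"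
  shows "f (a + h) y - f a y \<le> f (b + h) y - f b y"
proof (cases "a = b \<or> h = 0")
  case False
  define l where "l = b + h - a"
  have l: "l > 0" "h < l"
    using assms False by (auto simp: l_def)
  define s where "s = h / l"
  have s: "0 \<le> s" "s \<le> 1"
    using l assms by (auto simp: s_def)
  have hs: "h = s * l"
    using l by (simp add: s_def)
  have ab: "a + h = (1 - s) * a + s * (b + h)" "b = s * a + (1 - s) * (b + h)"
  proof -
    have "(1 - s) * a + s * (b + h) = a + s * l" "s * a + (1 - s) * (b + h) = b + h - s * l"
      by (simp_all add: l_def algebra_simps)
    then show "a + h = (1 - s) * a + s * (b + h)" "b = s * a + (1 - s) * (b + h)"
      using hs by auto
  qed
  have "f (a + h) y \<le> (1 - s) * f a y + s * f (b + h) y"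
    using convex_onD[OF f_convex[OF assms(4)], of s a "b + h"] s assms
    by (subst ab(1)) simp
  moreover have "f b y \<le> s * f a y + (1 - s) * f (b + h) y"
    using convex_onD[OF f_convex[OF assms(4)], of "1 - s" a "b + h"] s assms
    by (subst ab(2)) simp
  ultimately show ?thesis
    by (simp add: algebra_simps)
qed auto

lemma edge_weight_nonneg_sym:
  assumes "bicyclic_arcs n E"
  shows "nonneg_sym n (edge_weight f E)"
proof -
  have "edge_weight f E i j = edge_weight f E j i" for i j
  proof (cases "(i, j) \<in> E")
    case True
    then have "(j, i) \<in> E"
      by (rule bicyclic_arcsD(3)[OF assms])
    then show ?thesis
      using True dg_pos[OF assms True] dg_pos[OF assms \<open>(j, i) \<in> E\<close>] by (simp add: edge_weight_def f_sym)
  qed (use bicyclic_arcsD(3)[OF assms] in \<open>auto simp: edge_weight_def\<close>)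
  moreover have "0 \<le> edge_weight f E i j" for i j
    using weight_pos[OF assms, of i j] by (auto simp: edge_weight_def)
  ultimately show ?thesis
    by (simp add: nonneg_sym_def)
qed

lemma perron:
  assumes "bicyclic_arcs n E"
  obtains x where "sqnorm n x = 1" "\<And>i. i < n \<Longrightarrow> 0 < x i"
    "\<And>i. i < n \<Longrightarrow> (\<Sum>j<n. edge_weight f E i j * x j) = R E * x i"
    "qform n (edge_weight f E) x = R E"
proof (rule perron_vector[OF n edge_weight_nonneg_sym[OF assms]])
  show "i < n \<and> j < n \<and> 0 < edge_weight f E i j" if "(i, j) \<in> E" for i j
    using that weight_pos[OF assms that] bicyclic_arcsD[OF assms] by (simp add: edge_weight_def)
  show "(i, j) \<in> E\<^sup>*" if "i < n" "j < n" for i j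
    using that bicyclic_arcsD(5)[OF assms] by blast
qed (use that in blast)

end

locale weight_shift = bicyclic_weight + shift_setup
begin

text \<open>
  In the last hypothesis, the left-hand side is the loss at the private neighbours of \<open>v\<close> that stay
  at \<open>v\<close>, whose edges get lighter because the degree of \<open>v\<close> drops; everywhere else the change of the
  quadratic form is nonnegative by monotonicity, convexity and the balance condition.
\<close>

lemma shift_increases:
  assumes bic': "bicyclic_arcs n E'"
    and x: "sqnorm n x = 1" "\<And>i. i < n \<Longrightarrow> 0 < x i"
      "\<And>i. i < n \<Longrightarrow> (\<Sum>j<n. edge_weight f E i j * x j) = R E * x i"
      "qform n (edge_weight f E) x = R E"
    and xuv: "x v \<le> x u"
    and dvu: "dg E v \<le> dg E u + card S"
    and rest: "(\<Sum>j\<in>nb E v - nb E u - insert u S.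
          x j * (x v * (f (dg E v) (dg E j) - f (dg E v - card S) (dg E j))))
        \<le> (\<Sum>j\<in>S. x j * (f (dg E u + card S) (dg E j) * x u - f (dg E v) (dg E j) * x v))"
  shows "R E < R E'"
proof -
  note B = bicyclic_arcsD[OF bic]
  define D where "D = (\<lambda>i j. edge_weight f E' i j - edge_weight f E i j)"
  define T where "T = nb E v - nb E u - insert u S"
  define V where "V = {..<n} - {u, v}"
  have W: "nonneg_sym n (edge_weight f E)" "nonneg_sym n (edge_weight f E')"
    using edge_weight_nonneg_sym bic bic' by auto
  have E'u: "(u, j) \<in> E' \<longleftrightarrow> (u, j) \<in> E \<or> j \<in> S" for j
    using nb_u by auto
  have E'v: "(v, j) \<in> E' \<longleftrightarrow> (v, j) \<in> E \<and> j \<notin> S" for j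
    using nb_v by auto
  have one: "1 \<le> dg E i" "1 \<le> dg E j" if "(i, j) \<in> E" for i j
    using dg_pos[OF bic that] dg_pos[OF bic B(3)[OF that]] .
  have one': "1 \<le> dg E' i" "1 \<le> dg E' j" if "(i, j) \<in> E'" for i j
    using dg_pos[OF bic' that] dg_pos[OF bic' sym_shift[OF that]] .
  have Sv: "(v, j) \<in> E" "(u, j) \<notin> E" "j \<noteq> u" "j \<noteq> v" "j < n" if "j \<in> S" for j
    using that S v_notin B(2) by auto
  have Du: "D u j = (if j \<in> S then f (dg E u + card S) (dg E j)
      else if (u, j) \<in> E then f (dg E u + card S) (dg E j) - f (dg E u) (dg E j) else 0)"
    if "j \<in> V" for j
    using that Sv[of j] unfolding D_def edge_weight_def E'u dg_u by (simp add: V_def dg_other)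
  have Dv: "D v j = (if j \<in> S then - f (dg E v) (dg E j)
      else if (v, j) \<in> E then f (dg E v - card S) (dg E j) - f (dg E v) (dg E j) else 0)"
    if "j \<in> V" for j
    using that Sv[of j] unfolding D_def edge_weight_def E'v dg_v by (simp add: V_def dg_other)
  have Du_nonneg: "0 \<le> D u j" if "j \<in> V" for j
  proof (cases "j \<in> S")
    case True
    then have "0 \<le> edge_weight f E' u j" "edge_weight f E u j = 0"
      using W(2) uv(2) Sv[of j] by (auto simp: nonneg_sym_def edge_weight_def)
    then show ?thesis
      by (simp add: D_def)
  next
    case False
    then show ?thesis
      using that one[of u j] f_mono[of "dg E u" "dg E u + card S" "dg E j"] by (auto simp: Du)
  qed
  have Duv: "0 \<le> D u v"
  proof (cases "(u, v) \<in> E")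
    case True
    then have "(v, u) \<in> E'"
      using B(3) S(3) by (auto simp: E'v)
    then have "1 \<le> dg E v - card S"
      using one'(1) dg_v by metis
    then have k: "real (dg E v - card S) = real (dg E v) - real (card S)" "1 \<le> real (dg E v) - real (card S)"
      by linarith+
    have "f (dg E u) (dg E v) \<le> f (dg E u + card S) (dg E v - card S)"
      unfolding k using k(2) one[OF True] dvu by (intro f_balance) linarith+
    then show ?thesis
      using True v_notin unfolding D_def edge_weight_def E'u dg_u dg_v by simp
  qed (use v_notin in \<open>simp add: D_def edge_weight_def E'u\<close>)
  define t where "t = (\<lambda>j. x j * (D u j * x u + D v j * x v))"
  have xpos: "0 < x u" "0 < x v"
    using x(2) uv by auto
  have t_nonneg: "0 \<le> t j" if j: "j \<in> V - S - T" for j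
  proof -
    have jV: "j \<in> V" "j \<notin> S" "0 < x j"
      using j x(2) by (auto simp: V_def)
    have "0 \<le> D u j * x u + D v j * x v"
    proof (cases "(v, j) \<in> E")
      case True
      then have uj: "(u, j) \<in> E"
        using j by (auto simp: T_def V_def)
      have "(v, j) \<in> E'"
        using True jV by (simp add: E'v)
      then have "1 \<le> dg E v - card S"
        using one'(1) dg_v by metis
      then have k: "real (dg E v - card S) = real (dg E v) - real (card S)" "1 \<le> real (dg E v) - real (card S)"
        by linarith+
      have "f ((real (dg E v) - real (card S)) + real (card S)) (dg E j) - f (real (dg E v) - real (card S)) (dg E j)
          \<le> f (real (dg E u) + real (card S)) (dg E j) - f (dg E u) (dg E j)"
        using k(2) one[OF True] one[OF uj] dvu by (intro f_increment) auto
      then have "- D v j \<le> D u j"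
        using True uj jV by (simp add: Du Dv k)
      then have "- D v j * x v \<le> D u j * x v"
        using xpos by (intro mult_right_mono) auto
      also have "\<dots> \<le> D u j * x u"
        using xuv Du_nonneg[OF jV(1)] by (rule mult_left_mono)
      finally show ?thesis
        by simp
    next
      case False
      then show ?thesis
        using jV Du_nonneg[OF jV(1)] xpos by (simp add: Dv)
    qed
    then show ?thesis
      using jV by (simp add: t_def)
  qed
  have fin: "finite S" "finite T" "finite V" "S \<subseteq> V" "T \<subseteq> V" "S \<inter> T = {}"
    using finite_S B(8)[of v] Sv B(2,4) by (auto simp: V_def T_def)
  have "sum t V = sum t (V - S) + sum t S"
    using fin by (intro sum.subset_diff) auto
  moreover have "sum t (V - S) = sum t (V - S - T) + sum t T"
    using fin by (intro sum.subset_diff) auto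
  moreover have "sum t S = (\<Sum>j\<in>S. x j * (f (dg E u + card S) (dg E j) * x u - f (dg E v) (dg E j) * x v))"
    using fin by (intro sum.cong) (auto simp: t_def Du Dv subset_iff)
  moreover have "sum t T = - (\<Sum>j\<in>T. x j * (x v * (f (dg E v) (dg E j) - f (dg E v - card S) (dg E j))))"
    unfolding sum_negf[symmetric] using fin
    by (intro sum.cong) (auto simp: t_def Du Dv subset_iff T_def algebra_simps)
  moreover have "0 \<le> sum t (V - S - T)"
    using t_nonneg by (rule sum_nonneg)
  ultimately have "0 \<le> sum t V"
    using rest by (simp add: T_def)
  moreover have "qform n D x = 2 * sum t V + 2 * (D u v * x u * x v)"
    unfolding t_def V_def
  proof (rule qform_two_rows)
    show "D i j = D j i" if "i < n" "j < n" for i j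
      using W that by (simp add: D_def nonneg_sym_def)
    show "D i j = 0" if "i \<notin> {u, v}" "j \<notin> {u, v}" for i j
    proof -
      have "(i, j) \<in> E' \<longleftrightarrow> (i, j) \<in> E"
        using that by (auto simp: shift_def)
      then show ?thesis
        using that by (simp add: D_def edge_weight_def dg_other)
    qed
    show "D u u = 0" "D v v = 0"
      using B(4) bicyclic_arcsD(4)[OF bic'] by (auto simp: D_def edge_weight_def)
  qed (use uv in auto)
  ultimately have "0 \<le> qform n D x"
    using Duv xpos by simp
  then have q: "R E \<le> qform n (edge_weight f E') x"
    using x(4) unfolding D_def qform_diff by simp
  have "(\<Sum>j<n. edge_weight f E u j * x j) < (\<Sum>j<n. edge_weight f E' u j * x j)"
  proof (rule sum_strict_mono_ex1)
    show "\<forall>j\<in>{..<n}. edge_weight f E u j * x j \<le> edge_weight f E' u j * x j"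
    proof
      fix j assume j: "j \<in> {..<n}"
      have "0 \<le> D u j"
      proof (cases "j = u \<or> j = v")
        case True
        then show ?thesis
          using Duv B(4) bicyclic_arcsD(4)[OF bic'] by (auto simp: D_def edge_weight_def)
      qed (use j Du_nonneg in \<open>simp add: V_def\<close>)
      then show "edge_weight f E u j * x j \<le> edge_weight f E' u j * x j"
        using x(2)[of j] j by (simp add: D_def)
    qed
    obtain s where s: "s \<in> S"
      using S(4) by blast
    then have "(u, s) \<in> E'"
      by (simp add: E'u)
    then have "edge_weight f E u s = 0" "0 < edge_weight f E' u s"
      using weight_pos[OF bic'] Sv[OF s] by (auto simp: edge_weight_def)
    then show "\<exists>j\<in>{..<n}. edge_weight f E u j * x j < edge_weight f E' u j * x j"
      using Sv[OF s] x(2) by (intro bexI[of _ s]) auto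
  qed simp
  then have "R E * x u < (\<Sum>j<n. edge_weight f E' u j * x j)"
    using x(3) uv by simp
  then show ?thesis
    using spec_rad_strict_mono[OF n W(2) x(1) q uv(2)] by blast
qed

end

lemma (in bicyclic_weight) kelmans_increases:
  assumes bic: "bicyclic_arcs n E" and uv: "u < n" "v < n" "u \<noteq> v"
    and near: "(u, v) \<in> E \<or> (\<exists>w. (u, w) \<in> E \<and> (v, w) \<in> E)"
    and private_nb: "nb E u - insert v (nb E v) \<noteq> {}" "nb E v - insert u (nb E u) \<noteq> {}"
  shows "\<exists>p q. {p, q} = {u, v} \<and> bicyclic_arcs n (shift E p q (nb E q - insert p (nb E p))) \<and>
    R E < R (shift E p q (nb E q - insert p (nb E p)))"
proof -
  obtain x where x: "sqnorm n x = 1" "\<And>i. i < n \<Longrightarrow> 0 < x i"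
    "\<And>i. i < n \<Longrightarrow> (\<Sum>j<n. edge_weight f E i j * x j) = R E * x i"
    "qform n (edge_weight f E) x = R E"
    by (rule perron[OF bic]) (rule that)
  have main: "bicyclic_arcs n (shift E p q S) \<and> R E < R (shift E p q S)"
    if pq: "{p, q} = {u, v}" and le: "x q \<le> x p" and Sdef: "S = nb E q - insert p (nb E p)" for p q S
  proof -
    note B = bicyclic_arcsD[OF bic]
    have near': "(p, q) \<in> E \<or> (\<exists>w. (p, w) \<in> E \<and> (q, w) \<in> E)"
      using pq near B(3) by (auto simp: doubleton_eq_iff)
    interpret weight_shift n f E p q S
      using pq uv private_nb Sdef bic B(4) by unfold_locales (auto simp: doubleton_eq_iff)
    have "nb E q - {p} \<subseteq> (nb E p - {q}) \<union> S"
      using Sdef B(4) by auto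
    then have "card (nb E q - {p}) \<le> card ((nb E p - {q}) \<union> S)"
      using B(8) finite_S by (intro card_mono) auto
    also have "\<dots> \<le> card (nb E p - {q}) + card S"
      by (rule card_Un_le)
    finally have "card (nb E q - {p}) \<le> card (nb E p - {q}) + card S" .
    moreover have "p \<in> nb E q \<longleftrightarrow> q \<in> nb E p"
      using B(3) by auto
    ultimately have "dg E q \<le> dg E p + card S"
      using B(8)[of p] B(8)[of q] dg_pos[OF bic, of p q] by (cases "p \<in> nb E q") (auto simp: card_Diff_singleton)
    moreover have "nb E q - nb E p - insert p S = {}"
      using Sdef by auto
    moreover have "0 \<le> (\<Sum>j\<in>S. x j * (f (dg E p + card S) (dg E j) * x p - f (dg E q) (dg E j) * x q))"
    proof (rule sum_nonneg)
      fix j assume j: "j \<in> S"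
      then have qj: "(q, j) \<in> E" "j < n"
        using Sdef B(2) by auto
      then have d: "1 \<le> dg E q" "1 \<le> dg E j"
        using dg_pos[OF bic] B(3) by blast+
      have "f (dg E q) (dg E j) \<le> f (dg E p + card S) (dg E j)"
        using d \<open>dg E q \<le> dg E p + card S\<close> by (intro f_mono) auto
      moreover have "0 < f (dg E q) (dg E j)" "0 < x q"
        using weight_pos[OF bic qj(1)] x(2) uv(3) uv pq by auto
      ultimately have "f (dg E q) (dg E j) * x q \<le> f (dg E p + card S) (dg E j) * x p"
        using le by (intro mult_mono) auto
      then show "0 \<le> x j * (f (dg E p + card S) (dg E j) * x p - f (dg E q) (dg E j) * x q)"
        using x(2)[OF qj(2)] by simp
    qed
    ultimately have "R E < R E'"
      by (intro shift_increases[OF shift_bicyclic_arcs[OF near'] x le]) (simp_all only: sum.empty)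
    then show ?thesis
      using shift_bicyclic_arcs[OF near'] by simp
  qed
  show ?thesis
  proof (cases "x v \<le> x u")
    case True
    then show ?thesis
      using main[of u v] by blast
  next
    case False
    then show ?thesis
      using main[of v u, OF insert_commute _ refl] by (intro exI[of _ v] exI[of _ u]) auto
  qed
qed

section \<open>Dominating vertices\<close>

definition dominated :: "nat \<Rightarrow> (nat \<times> nat) set \<Rightarrow> bool" where
  "dominated n E \<longleftrightarrow> (\<exists>c<n. \<forall>j<n. j \<noteq> c \<longrightarrow> (c, j) \<in> E)"

definition symedges :: "(nat \<times> nat) set \<Rightarrow> (nat \<times> nat) set" where
  "symedges X = X \<union> X\<inverse>"

text \<open>
  \<open>shape1\<close> is \<open>K\<^sub>4\<^sup>-\<close> with all pendant vertices at one vertex \<open>c\<close> of degree 3 (the maximal graph), and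
  \<open>shape2\<close>, \<open>shape3\<close>, \<open>shape4\<close> are \<open>G\<^sub>2\<close>, \<open>G\<^sub>3\<close>, \<open>G\<^sub>4\<close> with arbitrary labels.
\<close>

definition shape1 :: "nat \<Rightarrow> (nat \<times> nat) set \<Rightarrow> bool" where
  "shape1 n E \<longleftrightarrow> (\<exists>c y p q. distinct [c, y, p, q] \<and> {c, y, p, q} \<subseteq> {..<n} \<and>
     E = symedges ({(y, p), (y, q)} \<union> {c} \<times> ({..<n} - {c})))"

definition shape2 :: "nat \<Rightarrow> (nat \<times> nat) set \<Rightarrow> bool" where
  "shape2 n E \<longleftrightarrow> (\<exists>c y p t q. distinct [c, y, p, t, q] \<and> {c, y, p, t, q} \<subseteq> {..<n} \<and>
     E = symedges ({(y, p), (t, q)} \<union> {c} \<times> ({..<n} - {c})))"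

definition shape3 :: "nat \<Rightarrow> (nat \<times> nat) set \<Rightarrow> bool" where
  "shape3 n E \<longleftrightarrow> (\<exists>x y v w. distinct [x, y, v, w] \<and> {x, y, v, w} \<subseteq> {..<n} \<and>
     E = symedges ({(x, y), (x, v), (x, w), (y, v), (y, w)} \<union> {v} \<times> ({..<n} - {x, y, v, w})))"

definition shape4 :: "nat \<Rightarrow> (nat \<times> nat) set \<Rightarrow> bool" where
  "shape4 n E \<longleftrightarrow> (\<exists>x y v w t. distinct [x, y, v, w, t] \<and> {x, y, v, w, t} \<subseteq> {..<n} \<and>
     E = symedges ({(x, y), (x, v), (x, w), (y, v), (y, w), (y, t)} \<union>
       {x} \<times> ({..<n} - {x, y, v, w, t})))"

lemma card_remove_vertex:
  assumes "finite E" "sym E" "irrefl E"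
  shows "card E = card (E \<inter> ((- {c}) \<times> (- {c}))) + 2 * dg E c"
proof -
  have fin: "finite (nb E c)"
    using assms(1) by (rule finite_Image)
  have "E = (E \<inter> ((- {c}) \<times> (- {c}))) \<union> ({c} \<times> nb E c \<union> nb E c \<times> {c})"
    using assms(2) by (auto dest: symD)
  also have "card \<dots> = card (E \<inter> ((- {c}) \<times> (- {c}))) + card ({c} \<times> nb E c \<union> nb E c \<times> {c})"
    using assms(1) fin by (intro card_Un_disjoint) auto
  also have "card ({c} \<times> nb E c \<union> nb E c \<times> {c}) = dg E c + dg E c"
    using fin assms(3) by (subst card_Un_disjoint) (auto simp: irrefl_def card_cartesian_product)
  finally show ?thesis
    by simp
qed

lemma sym_card_2E:
  assumes "sym F" "irrefl F" "card F = 2"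
  obtains a b where "a \<noteq> b" "F = {(a, b), (b, a)}"
proof -
  have fin: "finite F"
    using assms(3) by (metis card.infinite zero_neq_numeral)
  have "F \<noteq> {}"
    using assms(3) by auto
  then obtain a b where ab: "(a, b) \<in> F"
    by auto
  then have "(b, a) \<in> F" "a \<noteq> b"
    using assms(1,2) by (auto dest: symD simp: irrefl_def)
  then have "{(a, b), (b, a)} = F"
    using ab assms(3) fin by (intro card_subset_eq) auto
  then show thesis
    using that \<open>a \<noteq> b\<close> by blast
qed

lemma sym_card_4E:
  assumes "sym F" "irrefl F" "card F = 4"
  obtains a b c d where "a \<noteq> b" "c \<noteq> d" "{a, b} \<noteq> {c, d}" "F = {(a, b), (b, a), (c, d), (d, c)}"
proof -
  have fin: "finite F"
    using assms(3) by (metis card.infinite zero_neq_numeral)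
  have "F \<noteq> {}"
    using assms(3) by auto
  then obtain a b where ab: "(a, b) \<in> F"
    by auto
  then have ba: "(b, a) \<in> F" "a \<noteq> b"
    using assms(1,2) by (auto dest: symD simp: irrefl_def)
  have "card (F - {(a, b), (b, a)}) = 2"
    using ab ba assms(3) fin by (subst card_Diff_subset) auto
  moreover have "sym (F - {(a, b), (b, a)})" "irrefl (F - {(a, b), (b, a)})"
    using assms(1,2) by (auto simp: sym_def irrefl_def)
  ultimately obtain c d where cd: "c \<noteq> d" "F - {(a, b), (b, a)} = {(c, d), (d, c)}"
    using sym_card_2E by metis
  have "F = {(a, b), (b, a)} \<union> (F - {(a, b), (b, a)})"
    using ab ba by blast
  then have "F = {(a, b), (b, a), (c, d), (d, c)}"
    unfolding cd(2) by blast
  moreover have "(c, d) \<in> F - {(a, b), (b, a)}"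
    unfolding cd(2) by simp
  then have "{a, b} \<noteq> {c, d}"
    by (auto simp: doubleton_eq_iff)
  ultimately show thesis
    using that ba cd by blast
qed

lemma dominated_shapes:
  assumes bic: "bicyclic_arcs n E" and dom: "dominated n E"
  shows "shape1 n E \<or> shape2 n E"
proof -
  note B = bicyclic_arcsD[OF bic]
  have sym: "sym E" "irrefl E" and V: "E \<subseteq> {..<n} \<times> {..<n}"
    using bic by (auto simp: bicyclic_arcs_def)
  obtain c where c: "c < n" "\<And>j. j < n \<Longrightarrow> j \<noteq> c \<Longrightarrow> (c, j) \<in> E"
    using dom by (auto simp: dominated_def)
  define F where "F = E \<inter> ((- {c}) \<times> (- {c}))"
  have nbc: "nb E c = {..<n} - {c}"
    using c B(2,4) by auto
  then have "dg E c = n - 1"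
    using c(1) by simp
  then have "card F = 4"
    using card_remove_vertex[OF B(7) sym, of c] B(6) c(1) by (simp add: F_def)
  moreover have "sym F" "irrefl F"
    using sym by (auto simp: F_def sym_def irrefl_def)
  ultimately obtain a b d e where abde: "a \<noteq> b" "d \<noteq> e" "{a, b} \<noteq> {d, e}"
    and F: "F = {(a, b), (b, a), (d, e), (e, d)}"
    using sym_card_4E by metis
  have "(a, b) \<in> F" "(d, e) \<in> F"
    using F by auto
  then have notc: "{a, b, d, e} \<subseteq> {..<n} - {c}"
    using V by (auto simp: F_def)
  have "E = F \<union> symedges ({c} \<times> ({..<n} - {c}))"
  proof -
    have "E = F \<union> symedges ({c} \<times> nb E c)"
      using B(3) by (auto simp: F_def symedges_def)
    then show ?thesis
      unfolding nbc .
  qed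
  then have E: "E = symedges ({(a, b), (d, e)} \<union> {c} \<times> ({..<n} - {c}))"
    unfolding F symedges_def by blast
  have one: "shape1 n E" if "y \<noteq> p" "y \<noteq> q" "p \<noteq> q" "{y, p, q} \<subseteq> {..<n} - {c}"
    "E = symedges ({(y, p), (y, q)} \<union> {c} \<times> ({..<n} - {c}))" for y p q
    unfolding shape1_def
    by (rule exI[of _ c], rule exI[of _ y], rule exI[of _ p], rule exI[of _ q]) (use that c(1) in auto)
  have two: "shape2 n E" if "distinct [a, b, d, e]"
    unfolding shape2_def
    by (rule exI[of _ c], rule exI[of _ a], rule exI[of _ b], rule exI[of _ d], rule exI[of _ e])
      (use that notc c(1) E in auto)
  consider "distinct [a, b, d, e]" | "a = d" | "a = e" | "b = d" | "b = e"
    using abde by auto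
  then show ?thesis
  proof cases
    case 1
    then show ?thesis
      using two by blast
  next
    case 2
    have "E = symedges ({(a, b), (a, e)} \<union> {c} \<times> ({..<n} - {c}))"
      unfolding E 2 symedges_def by blast
    then have "shape1 n E"
      by (rule one[rotated 4]) (use 2 notc abde in auto)
    then show ?thesis ..
  next
    case 3
    have "E = symedges ({(a, b), (a, d)} \<union> {c} \<times> ({..<n} - {c}))"
      unfolding E 3 symedges_def by blast
    then have "shape1 n E"
      by (rule one[rotated 4]) (use 3 notc abde in auto)
    then show ?thesis ..
  next
    case 4
    have "E = symedges ({(b, a), (b, e)} \<union> {c} \<times> ({..<n} - {c}))"
      unfolding E 4 symedges_def by blast
    then have "shape1 n E"
      by (rule one[rotated 4]) (use 4 notc abde in auto)
    then show ?thesis ..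
  next
    case 5
    have "E = symedges ({(b, a), (b, d)} \<union> {c} \<times> ({..<n} - {c}))"
      unfolding E 5 symedges_def by blast
    then have "shape1 n E"
      by (rule one[rotated 4]) (use 5 notc abde in auto)
    then show ?thesis ..
  qed
qed

lemma not_dominated_private_neighbours:
  assumes bic: "bicyclic_arcs n E" and n: "n > 0" and nd: "\<not> dominated n E"
  obtains u v where "(u, v) \<in> E" "nb E u - insert v (nb E v) \<noteq> {}" "nb E v - insert u (nb E u) \<noteq> {}"
proof -
  note B = bicyclic_arcsD[OF bic]
  have "Max (dg E ` {..<n}) \<in> dg E ` {..<n}"
    using n by (intro Max_in) auto
  then obtain u where "u < n" "dg E u = Max (dg E ` {..<n})"
    by auto
  then have u: "u < n" "\<And>w. w < n \<Longrightarrow> dg E w \<le> dg E u"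
    by auto
  obtain w where w: "w < n" "w \<noteq> u" "(u, w) \<notin> E"
    using nd u(1) by (auto simp: dominated_def)
  have "\<exists>v\<in>nb E u. nb E v - insert u (nb E u) \<noteq> {}"
  proof (rule ccontr)
    assume *: "\<not> ?thesis"
    have "j \<in> insert u (nb E u)" if "(u, j) \<in> E\<^sup>*" for j
      using that
    proof induction
      case (step i j)
      then show ?case
        using * by (cases "i = u") auto
    qed simp
    then show False
      using B(5)[OF u(1) w(1)] w by auto
  qed
  then obtain v where v: "(u, v) \<in> E" "nb E v - insert u (nb E u) \<noteq> {}"
    by auto
  have "nb E u - insert v (nb E v) \<noteq> {}"
  proof
    assume *: "nb E u - insert v (nb E v) = {}"
    obtain z where z: "z \<in> nb E v" "z \<notin> insert u (nb E u)"
      using v(2) by auto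
    have "insert z (insert u (nb E u - {v})) \<subseteq> nb E v"
      using * z(1) B(3)[OF v(1)] by auto
    then have "card (insert z (insert u (nb E u - {v}))) \<le> dg E v"
      by (rule card_mono[OF B(8)])
    moreover have "card (insert z (insert u (nb E u - {v}))) = Suc (Suc (card (nb E u - {v})))"
      using z(2) B(4) B(8)[of u] by simp
    moreover have "Suc (card (nb E u - {v})) = dg E u"
      using v(1) B(8)[of u] by (intro card.remove[symmetric]) auto
    ultimately show False
      using u(2)[of v] B(2)[OF v(1)] by simp
  qed
  then show thesis
    using that v by blast
qed

lemma (in shift_setup) shift_dominated:
  assumes "\<not> dominated n E" "dominated n E'" "j < n" "j \<noteq> u"
  shows "j \<in> nb E u \<union> S"
proof -
  obtain z where z: "z < n" "\<And>j. j < n \<Longrightarrow> j \<noteq> z \<Longrightarrow> j \<in> nb E' z"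
    using assms(2) by (auto simp: dominated_def)
  have "z = u"
  proof (rule ccontr)
    assume zu: "z \<noteq> u"
    have "nb E' z \<subseteq> nb E z"
    proof (cases "z = v \<or> z \<in> S")
      case True
      then show ?thesis
      proof
        assume "z \<in> S"
        then have "v \<notin> nb E' z"
          using uv(1) nb_S by auto
        then show ?thesis
          using z(2)[of v] \<open>z \<in> S\<close> v_notin uv(3) by auto
      qed (use nb_v in auto)
    qed (use zu nb_other in auto)
    then have "dominated n E"
      using z unfolding dominated_def by blast
    then show False
      using assms(1) by simp
  qed
  then show ?thesis
    using z(2)[of j] assms(3,4) nb_u by simp
qed

context bicyclic_weight
begin

lemma f_multi_increment:
  assumes "real k + 1 \<le> b" "1 \<le> y"
  shows "f b y - f (b - real k) y \<le> real k * (f (b + 1) y - f b y)"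
  using assms(1)
proof (induction k)
  case (Suc k)
  have "f (b - real (Suc k) + 1) y - f (b - real (Suc k)) y \<le> f (b + 1) y - f b y"
    using Suc.prems assms(2) by (intro f_increment) auto
  then show ?case
    using Suc by (simp add: algebra_simps)
qed simp

text \<open>
  One pendant neighbour \<open>t\<close> stays at \<open>v\<close>. All pendant neighbours of \<open>v\<close> have the same Perron entry, so
  by convexity the loss at \<open>t\<close> is paid for by the \<open>k\<close> pendant vertices that move; the requirement of
  two private neighbours of \<open>u\<close> makes the degree of \<open>u\<close> grow beyond that of \<open>v\<close>.
\<close>

lemma pendant_shift_increases:
  assumes bic: "bicyclic_arcs n E" and edge: "(u, v) \<in> E"
    and x: "sqnorm n x = 1" "\<And>i. i < n \<Longrightarrow> 0 < x i"
      "\<And>i. i < n \<Longrightarrow> (\<Sum>j<n. edge_weight f E i j * x j) = R E * x i"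
      "qform n (edge_weight f E) x = R E"
    and xuv: "x v \<le> x u"
    and A: "2 \<le> card (nb E u - insert v (nb E v))"
    and P: "P = nb E v - insert u (nb E u)"
    and pendant: "\<And>b. b \<in> P \<Longrightarrow> nb E b = {v}"
    and t: "t \<in> P" "P - {t} \<noteq> {}"
  shows "bicyclic_arcs n (shift E u v (P - {t})) \<and> R E < R (shift E u v (P - {t}))"
proof -
  note B = bicyclic_arcsD[OF bic]
  interpret weight_shift n f E u v "P - {t}"
    using edge B t by unfold_locales (auto simp: P bic)
  have bic': "bicyclic_arcs n E'"
    using shift_bicyclic_arcs edge by blast
  define k where "k = card (P - {t})"
  define C where "C = nb E u \<inter> nb E v"
  have finC: "finite C" "finite P"
    using B(8) by (auto simp: C_def P)
  have "k > 0"
    using t(2) finC by (auto simp: k_def card_gt_0_iff)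
  have cardP: "card P = Suc k"
    unfolding k_def using t(1) finC by (intro card.remove)
  have nbv: "nb E v = insert u (C \<union> P)"
    using B(3)[OF edge] by (auto simp: C_def P)
  have "u \<notin> C \<union> P"
    using B(4) by (auto simp: C_def P)
  then have "dg E v = Suc (card (C \<union> P))"
    unfolding nbv using finC by simp
  moreover have "card (C \<union> P) = card C + card P"
    using finC by (intro card_Un_disjoint) (auto simp: C_def P)
  ultimately have dv: "dg E v = Suc (card C + Suc k)"
    using cardP by simp
  let ?A = "nb E u - insert v (nb E v)"
  have nbu: "nb E u = insert v (C \<union> ?A)"
    using edge by (auto simp: C_def)
  have "v \<notin> C \<union> ?A"
    using B(4) by (auto simp: C_def)
  then have "card (insert v (C \<union> ?A)) = Suc (card (C \<union> ?A))"
    using finC B(8) by simp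
  then have "dg E u = Suc (card (C \<union> ?A))"
    using nbu by metis
  moreover have "card (C \<union> ?A) = card C + card ?A"
    using finC B(8) by (intro card_Un_disjoint) (auto simp: C_def)
  ultimately have du: "card C + 3 \<le> dg E u"
    using A by simp
  have RE: "R E * x b = f 1 (dg E v) * x v" "0 < f (dg E v) 1" "f 1 (dg E v) = f (dg E v) 1"
    "b < n" "real (dg E b) = 1" if b: "b \<in> P" for b
  proof -
    have vb: "(v, b) \<in> E" "(b, v) \<in> E"
      using b B(3) by (auto simp: P)
    show "b < n"
      using vb B(2) by blast
    have "dg E b = 1"
      using pendant[OF b] by simp
    then show db: "real (dg E b) = 1"
      by simp
    have "edge_weight f E b j = (if j = v then f 1 (dg E v) else 0)" for j
      using pendant[OF b] db by (auto simp: edge_weight_def)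
    then have "(\<Sum>j<n. edge_weight f E b j * x j) = f 1 (dg E v) * x v"
      using B(1)[OF vb(1)] by (simp add: if_distrib[of "\<lambda>c. c * _"] cong: if_cong)
    then show "R E * x b = f 1 (dg E v) * x v"
      using x(3)[OF \<open>b < n\<close>] by simp
    show "0 < f (dg E v) 1"
      using weight_pos[OF bic vb(1)] db by simp
    show "f 1 (dg E v) = f (dg E v) 1"
      using dg_pos[OF bic vb(1)] by (intro f_sym) auto
  qed
  have xpos: "0 < x u" "0 < x v" "0 < x t"
    using x(2) B(1,2) edge RE(4)[OF t(1)] by auto
  have "R E * x t \<noteq> 0"
    using RE(1-3)[OF t(1)] xpos by simp
  then have xP: "x b = x t" if "b \<in> P" for b
    using RE(1)[OF that] RE(1)[OF t(1)] by (metis mult_left_cancel mult_eq_0_iff)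
  have sum: "f (dg E v) 1 - f (real (dg E v) - real k) 1 \<le>
      real k * (f (dg E u + k) 1 - f (dg E v) 1)"
  proof -
    have "f (dg E v) 1 - f (real (dg E v) - real k) 1 \<le> real k * (f (real (dg E v) + 1) 1 - f (dg E v) 1)"
      using dv by (intro f_multi_increment) auto
    also have "\<dots> \<le> real k * (f (dg E u + k) 1 - f (dg E v) 1)"
      using dv du by (intro mult_left_mono diff_right_mono f_mono) auto
    finally show ?thesis .
  qed
  have T: "nb E v - nb E u - insert u (P - {t}) = {t}"
    using t(1) by (auto simp: P)
  have kv: "real (dg E v - k) = real (dg E v) - real k"
    using dv by simp
  have "(\<Sum>j\<in>{t}. x j * (x v * (f (dg E v) (dg E j) - f (dg E v - k) (dg E j)))) =
      x t * x v * (f (dg E v) 1 - f (real (dg E v) - real k) 1)"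
    using RE(5)[OF t(1)] by (simp add: kv)
  also have "\<dots> \<le> x t * x v * (real k * (f (dg E u + k) 1 - f (dg E v) 1))"
    using sum xpos by (intro mult_left_mono) auto
  also have "\<dots> = real k * (x t * (f (dg E u + k) 1 * x v - f (dg E v) 1 * x v))"
    by (simp add: algebra_simps)
  also have "\<dots> \<le> real k * (x t * (f (dg E u + k) 1 * x u - f (dg E v) 1 * x v))"
  proof -
    have "f (dg E v) 1 \<le> f (dg E u + k) 1"
      using dv du by (intro f_mono) auto
    then have "0 \<le> f (dg E u + k) 1"
      using RE(2)[OF t(1)] by simp
    then show ?thesis
      using xuv xpos by (intro mult_left_mono diff_right_mono) auto
  qed
  also have "\<dots> = (\<Sum>j\<in>P - {t}. x j * (f (dg E u + k) (dg E j) * x u - f (dg E v) (dg E j) * x v))"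
    by (simp add: k_def xP RE(5))
  finally have "R E < R E'"
    using du dv by (intro shift_increases[OF bic' x xuv]) (simp_all add: T k_def)
  then show ?thesis
    using bic' by simp
qed

lemma kelmans_improves:
  assumes bic: "bicyclic_arcs n E" and nd: "\<not> dominated n E" and uv: "u \<noteq> v"
    and near: "(u, v) \<in> E \<or> (\<exists>w. (u, w) \<in> E \<and> (v, w) \<in> E)"
    and private_nb: "nb E u - insert v (nb E v) \<noteq> {}" "nb E v - insert u (nb E u) \<noteq> {}"
    and miss: "(u, v) \<in> E \<Longrightarrow> nb E u \<union> nb E v \<noteq> {..<n}"
  shows "\<exists>E'. bicyclic_arcs n E' \<and> \<not> dominated n E' \<and> R E < R E'"
proof -
  note B = bicyclic_arcsD[OF bic]
  have un: "u < n" "v < n"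
    using near B(1,2) by blast+
  obtain p q where pq: "{p, q} = {u, v}"
    and K: "bicyclic_arcs n (shift E p q (nb E q - insert p (nb E p)))"
      "R E < R (shift E p q (nb E q - insert p (nb E p)))"
    using kelmans_increases[OF bic un uv near private_nb] by blast
  interpret shift_setup n E p q "nb E q - insert p (nb E p)"
    using pq un uv private_nb bic by unfold_locales (auto simp: doubleton_eq_iff)
  have "\<not> dominated n E'"
  proof
    assume "dominated n E'"
    then have cov: "j \<in> nb E p \<union> nb E q" if "j < n" "j \<noteq> p" for j
      using shift_dominated[OF nd _ that] by blast
    have "q \<in> nb E p"
      using shift_dominated[OF nd \<open>dominated n E'\<close> uv(3)] uv(1) B(4) by auto
    then have "(p, q) \<in> E" "(q, p) \<in> E"
      using B(3) by auto
    then have "nb E p \<union> nb E q = {..<n}" "(u, v) \<in> E"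
      using cov B(1,2) pq by (auto simp: doubleton_eq_iff)
    then show False
      using miss pq by (auto simp: doubleton_eq_iff)
  qed
  then show ?thesis
    using K by blast
qed

end

section \<open>Pairs of vertices that admit no improving move\<close>

text \<open>
  \<open>nested\<close> and \<open>adjacent\<close> say that no pair of vertices can be improved by moving all private
  neighbours without creating a dominating vertex.
\<close>

locale tight_pair =
  fixes n :: nat and E :: "(nat \<times> nat) set" and u v :: nat
  assumes bic: "bicyclic_arcs n E" and n: "6 \<le> n"
    and edge: "(u, v) \<in> E"
    and cover: "nb E u \<union> nb E v = {..<n}"
    and private_nb: "nb E u - insert v (nb E v) \<noteq> {}" "nb E v - insert u (nb E u) \<noteq> {}"
    and nested: "\<And>p q w. \<lbrakk>p \<noteq> q; (p, q) \<notin> E; (p, w) \<in> E; (q, w) \<in> E\<rbrakk> \<Longrightarrow>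
      nb E p \<subseteq> nb E q \<or> nb E q \<subseteq> nb E p"
    and adjacent: "\<And>p q. (p, q) \<in> E \<Longrightarrow>
      nb E p \<subseteq> insert q (nb E q) \<or> nb E q \<subseteq> insert p (nb E p) \<or> nb E p \<union> nb E q = {..<n}"
begin

abbreviation "A \<equiv> nb E u - insert v (nb E v)"
abbreviation "B \<equiv> nb E v - insert u (nb E u)"
abbreviation "C \<equiv> nb E u \<inter> nb E v"

definition "F = {(i, j) \<in> E. i \<noteq> u \<and> i \<noteq> v \<and> j \<noteq> u \<and> j \<noteq> v}"

lemma swapped: "tight_pair n E v u"
  using bic n bicyclic_arcsD(3)[OF bic edge] cover private_nb nested adjacent
  by unfold_locales (auto simp: Un_commute)

lemma F_swapped: "tight_pair.F E v u = F"
  unfolding F_def tight_pair.F_def[OF swapped] by auto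

lemma F_sym: "(i, j) \<in> F \<Longrightarrow> (j, i) \<in> F"
  using bicyclic_arcsD(3)[OF bic] by (auto simp: F_def)

lemma finite_F: "finite F"
  using bicyclic_arcsD(7)[OF bic] by (rule rev_finite_subset) (auto simp: F_def)

lemma F_ABC: "(i, j) \<in> F \<Longrightarrow> i \<in> A \<union> B \<union> C" "(i, j) \<in> F \<Longrightarrow> j \<in> A \<union> B \<union> C"
  using cover bicyclic_arcsD(1,2)[OF bic] by (auto simp: F_def)

lemma uv: "u < n" "v < n" "u \<noteq> v" "(v, u) \<in> E" "u \<notin> nb E u" "v \<notin> nb E v"
  using bicyclic_arcsD(1-3)[OF bic edge] bicyclic_arcsD(4)[OF bic] edge by auto

lemma mem_A: "a \<in> A \<Longrightarrow> (a, x) \<in> E \<longleftrightarrow> x = u \<or> (a, x) \<in> F"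
  using bicyclic_arcsD(3,4)[OF bic] uv by (auto simp: F_def)

lemma mem_B: "b \<in> B \<Longrightarrow> (b, x) \<in> E \<longleftrightarrow> x = v \<or> (b, x) \<in> F"
  using bicyclic_arcsD(3,4)[OF bic] uv by (auto simp: F_def)

lemma mem_C: "c \<in> C \<Longrightarrow> (c, x) \<in> E \<longleftrightarrow> x = u \<or> x = v \<or> (c, x) \<in> F"
  using bicyclic_arcsD(3,4)[OF bic] uv by (auto simp: F_def)

lemma E_decomp: "E = symedges ({u} \<times> nb E u \<union> {v} \<times> nb E v) \<union> F"
  using bicyclic_arcsD(3)[OF bic] by (auto simp: F_def symedges_def)

lemma card_F: "card F + 2 * card C = 4"
proof -
  have sym: "sym E" "irrefl E"
    using bic by (auto simp: bicyclic_arcs_def)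
  note D = bicyclic_arcsD[OF bic]
  define E1 where "E1 = E \<inter> ((- {u}) \<times> (- {u}))"
  have "card E = card E1 + 2 * dg E u"
    using card_remove_vertex[OF D(7) sym] by (simp add: E1_def)
  moreover have "card E1 = card (E1 \<inter> ((- {v}) \<times> (- {v}))) + 2 * dg E1 v"
    using D(7) sym by (intro card_remove_vertex) (auto simp: E1_def sym_def irrefl_def)
  moreover have "E1 \<inter> ((- {v}) \<times> (- {v})) = F"
    by (auto simp: E1_def F_def)
  moreover have "nb E1 v = nb E v - {u}"
    using uv by (auto simp: E1_def)
  then have "dg E v = Suc (dg E1 v)"
    using card.remove[of "nb E v" u] uv(4) D(8)[of v] by simp
  moreover have "dg E u + dg E v = n + card C"
    using card_Un_Int[OF D(8)[of u] D(8)[of v]] cover by simp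
  ultimately show ?thesis
    using D(6) by simp
qed

lemma one_common_neighbour:
  assumes C: "C = {z}" and F: "F = {(p, q), (q, p)}" and p: "p \<in> A"
  shows "shape3 n E"
proof -
  note D = bicyclic_arcsD[OF bic]
  obtain b where b: "b \<in> B"
    using private_nb by blast
  have z: "(u, z) \<in> E" "(v, z) \<in> E" "z \<noteq> u" "z \<noteq> v" "(z, u) \<in> E" "(z, v) \<in> E"
    using C uv D(3) by blast+
  have q: "q \<in> A \<union> B \<union> {z}" "q \<noteq> u" "q \<noteq> v" "p \<noteq> q" "p \<noteq> z" "p \<noteq> u" "p \<noteq> v"
  proof -
    have pq: "(p, q) \<in> F"
      using F by simp
    then have "(p, q) \<in> E" "q \<noteq> u" "q \<noteq> v" "p \<noteq> u" "p \<noteq> v"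
      by (auto simp: F_def)
    then show "q \<in> A \<union> B \<union> {z}" "q \<noteq> u" "q \<noteq> v" "p \<noteq> q" "p \<noteq> z" "p \<noteq> u" "p \<noteq> v"
      using F_ABC(2)[OF pq] C p D(4) by auto
  qed
  have Ep: "(p, x) \<in> E \<longleftrightarrow> x = u \<or> x = q" for x
    using mem_A[OF p] F q by auto
  then have nbp: "nb E p = {u, q}"
    by auto
  have "q = z"
  proof (rule ccontr)
    assume "q \<noteq> z"
    then have nbz: "nb E z = {u, v}"
      using mem_C[of z] C F q by auto
    show False
    proof (cases "q \<in> A")
      case True
      have "(p, v) \<notin> E" "(p, u) \<in> E"
        using Ep q uv by auto
      then have "nb E p \<subseteq> nb E v \<or> nb E v \<subseteq> nb E p"
        using nested[of p v u] uv q by blast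
      moreover have "b \<notin> nb E p"
        using nbp True b uv by auto
      ultimately show False
        using nbp True b by auto
    next
      case False
      have "(p, z) \<notin> E" "(p, u) \<in> E"
        using Ep z \<open>q \<noteq> z\<close> q by auto
      then have "nb E p \<subseteq> nb E z \<or> nb E z \<subseteq> nb E p"
        using nested[of p z u] q z by blast
      then show False
        using nbp nbz q uv by auto
    qed
  qed
  then have nbz: "nb E z = {u, v, p}"
    using mem_C[of z] C F q by auto
  have "nb E z \<union> nb E v = {..<n}"
  proof -
    have "\<not> nb E z \<subseteq> insert v (nb E v)"
      using nbz p q by auto
    moreover have "b \<notin> insert z (nb E z)"
      using nbz b z p uv by auto
    ultimately show ?thesis
      using adjacent[OF z(6)] b by blast
  qed
  note cover_z = this
  have "A \<subseteq> {p}"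
  proof
    fix a assume a: "a \<in> A"
    then have "a \<in> nb E z \<union> nb E v"
      unfolding cover_z using D(2)[of u a] by simp
    then show "a \<in> {p}"
      using a uv(5) unfolding nbz by auto
  qed
  moreover have "nb E u = insert v (C \<union> A)"
    using edge by blast
  ultimately have nbu: "nb E u = {v, z, p}"
    using p unfolding C by auto
  have Eu: "(u, i) \<in> E \<longleftrightarrow> i \<in> {v, z, p}" for i
    unfolding nbu[symmetric] by simp
  have cov: "(u, i) \<in> E \<or> (v, i) \<in> E \<longleftrightarrow> i < n" for i
    using cover by blast
  have "(v, i) \<in> E \<longleftrightarrow> i < n \<and> i \<noteq> v \<and> i \<noteq> p" for i
    using cov[of i] Eu[of i] z(2) p uv(6) by blast
  then have nbv: "nb E v = {u, z} \<union> ({..<n} - {u, z, v, p})"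
    using q z uv D(2)[OF z(1)] by auto
  have "E = symedges ({(u, z), (u, v), (u, p), (z, v), (z, p)} \<union> {v} \<times> ({..<n} - {u, z, v, p}))"
    by (subst E_decomp) (simp only: nbu nbv F \<open>q = z\<close>, auto simp: symedges_def)
  moreover have "distinct [u, z, v, p]" "{u, z, v, p} \<subseteq> {..<n}"
    using q(5-7) z(3,4) uv(1-3) D(2)[OF z(1)] D(2)[of u p] Eu[of p] by auto
  ultimately show ?thesis
    unfolding shape3_def by blast
qed

lemma no_F_within_A:
  assumes a: "a \<in> A" "a' \<in> A"
  shows "(a, a') \<notin> F"
proof
  assume aa: "(a, a') \<in> F"
  have sub: "B \<subseteq> nb F c" if c: "c \<in> A" "c' \<in> A" "(c, c') \<in> F" for c c'
  proof -
    have "(c, v) \<notin> E" "c \<noteq> v" "(c, u) \<in> E" "(c, c') \<in> E"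
      using c bicyclic_arcsD(3)[OF bic] by (auto simp: F_def)
    then have "nb E c \<subseteq> nb E v \<or> nb E v \<subseteq> nb E c"
      using nested[of c v u] uv by blast
    then have "nb E v \<subseteq> nb E c"
      using c \<open>(c, c') \<in> E\<close> by auto
    then show ?thesis
      using mem_A[OF c(1)] by auto
  qed
  obtain b where b: "b \<in> B"
    using private_nb by blast
  have "(a, b) \<in> F" "(a', b) \<in> F"
    using sub[OF a aa] sub[OF a(2,1) F_sym[OF aa]] b by auto
  then have "{(a, a'), (a', a), (a, b), (b, a), (a', b), (b, a')} \<subseteq> F"
    using aa F_sym by auto
  moreover have "a \<noteq> a'" "a \<noteq> b" "a' \<noteq> b"
    using aa bicyclic_arcsD(4)[OF bic] a b by (auto simp: F_def)
  then have "card {(a, a'), (a', a), (a, b), (b, a), (a', b), (b, a')} = 6"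
    by simp
  ultimately have "6 \<le> card F"
    using finite_F by (metis card_mono)
  then show False
    using card_F by simp
qed

lemma no_fan:
  assumes C: "C = {}" and a: "a \<in> A" and b: "b \<in> B" "d \<in> B" "b \<noteq> d"
    and F: "F = {(a, b), (b, a), (a, d), (d, a)}"
  shows False
proof -
  note D = bicyclic_arcsD[OF bic]
  have nba: "nb E a = {u, b, d}"
    using mem_A[OF a] F a b by auto
  have nbb: "nb E b = {v, a}"
    using mem_B[OF b(1)] F a b by auto
  have "nb E u \<union> nb E a = {..<n}"
    using adjacent[of u a] nba a b edge uv C by auto
  then have B: "B \<subseteq> {b, d}"
    using nba cover uv by auto
  have "nb E v \<union> nb E b = {..<n}"
    using adjacent[of v b] nbb a b edge uv C by auto
  then have A: "A \<subseteq> {a}"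
    using nbb cover uv by auto
  have "{..<n} \<subseteq> {u, v, a, b, d}"
    using A B C cover by auto
  then have "card {..<n} \<le> card {u, v, a, b, d}"
    by (rule card_mono[rotated]) simp
  also have "\<dots> \<le> 5"
    by (auto simp: card_insert_if)
  finally show False
    using n by simp
qed

end

context tight_pair
begin

lemma common_neighbour: "C \<noteq> {}"
proof
  assume C: "C = {}"
  interpret sw: tight_pair n E v u
    by (rule swapped)
  note [simp] = F_swapped
  have C': "nb E v \<inter> nb E u = {}"
    using C by blast
  have "card F = 4"
    using card_F C by simp
  moreover have "sym F" "irrefl F"
    using F_sym bicyclic_arcsD(4)[OF bic] by (auto simp: sym_def irrefl_def F_def)
  ultimately obtain a b c d where F: "{a, b} \<noteq> {c, d}" "F = {(a, b), (b, a), (c, d), (d, c)}"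
    using sym_card_4E by metis
  have bip: "p \<in> A \<and> q \<in> B \<or> p \<in> B \<and> q \<in> A" if "(p, q) \<in> F" for p q
    using F_ABC[OF that] C no_F_within_A[of p q] sw.no_F_within_A[of p q] that
    unfolding F_swapped by blast
  have main: False if ab: "a \<in> A" "b \<in> B" and cd: "c \<in> A" "d \<in> B"
    and neq: "{a, b} \<noteq> {c, d}" and F: "F = {(a, b), (b, a), (c, d), (d, c)}" for a b c d
  proof -
    consider "a = c" | "b = d" | "a \<noteq> c" "b \<noteq> d"
      by blast
    then show False
    proof cases
      case 1
      then show False
        using no_fan[OF C, of a b d] ab cd neq F by auto
    next
      case 2
      then have "F = {(b, a), (a, b), (b, c), (c, b)}"
        using F by auto
      then show False
        using sw.no_fan[OF C', of b a c] ab cd neq 2 unfolding F_swapped by auto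
    next
      case 3
      have "nb E a = {u, b}" "nb E c = {u, d}"
        using mem_A[OF ab(1)] mem_A[OF cd(1)] F ab cd 3 by auto
      moreover have "(a, c) \<notin> E"
        using calculation ab cd by auto
      moreover have "b \<noteq> u" "d \<noteq> u"
        using ab cd by auto
      ultimately show False
        using nested[of a c u] 3 by auto
    qed
  qed
  have "(a, b) \<in> F" "(c, d) \<in> F"
    using F(2) by auto
  note bip[OF this(1)] bip[OF this(2)]
  then consider "a \<in> A \<and> b \<in> B" "c \<in> A \<and> d \<in> B" | "a \<in> A \<and> b \<in> B" "c \<in> B \<and> d \<in> A"
    | "a \<in> B \<and> b \<in> A" "c \<in> A \<and> d \<in> B" | "a \<in> B \<and> b \<in> A" "c \<in> B \<and> d \<in> A"
    by argo
  then show False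
  proof cases
    case 1
    then show False
      using main[of a b c d] F by blast
  next
    case 2
    have "F = {(a, b), (b, a), (d, c), (c, d)}" "{a, b} \<noteq> {d, c}"
      using F by blast+
    with 2 show False
      using main[of a b d c] by blast
  next
    case 3
    have "F = {(b, a), (a, b), (c, d), (d, c)}" "{b, a} \<noteq> {c, d}"
      using F by blast+
    with 3 show False
      using main[of b a c d] by blast
  next
    case 4
    have "F = {(b, a), (a, b), (d, c), (c, d)}" "{b, a} \<noteq> {d, c}"
      using F by blast+
    with 4 show False
      using main[of b a d c] by blast
  qed
qed

lemma tight_cases: "shape3 n E \<or> (card C = 2 \<and> F = {})"
proof -
  interpret sw: tight_pair n E v u
    by (rule swapped)
  have fin: "finite C"
    using bicyclic_arcsD(8)[OF bic] by simp
  have "card C \<noteq> 0"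
    using common_neighbour fin by simp
  then have "card C = 1 \<and> card F = 2 \<or> card C = 2 \<and> card F = 0"
    using card_F by arith
  then consider "card C = 1" "card F = 2" | "card C = 2" "card F = 0"
    by argo
  then show ?thesis
  proof cases
    case 1
    then obtain z where z: "C = {z}"
      by (metis card_1_singletonE)
    have "sym F" "irrefl F"
      using F_sym bicyclic_arcsD(4)[OF bic] by (auto simp: sym_def irrefl_def F_def)
    then obtain p q where pq: "p \<noteq> q" "F = {(p, q), (q, p)}"
      using sym_card_2E 1 by metis
    then have mem: "p \<in> A \<union> B \<union> C" "q \<in> A \<union> B \<union> C"
      using F_ABC by auto
    have qp: "F = {(q, p), (p, q)}" and z': "nb E v \<inter> nb E u = {z}"
      using pq z by auto
    consider "p \<in> A" | "p \<in> B" | "q \<in> A" | "q \<in> B"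
      using mem z pq by auto
    then have "shape3 n E"
    proof cases
      case 1
      then show ?thesis
        using one_common_neighbour[OF z pq(2)] by blast
    next
      case 2
      then show ?thesis
        using sw.one_common_neighbour[OF z'] pq(2) unfolding F_swapped by blast
    next
      case 3
      then show ?thesis
        using one_common_neighbour[OF z qp] by blast
    next
      case 4
      then show ?thesis
        using sw.one_common_neighbour[OF z'] qp unfolding F_swapped by blast
    qed
    then show ?thesis ..
  qed (use finite_F in auto)
qed

lemma pendant_B:
  assumes "F = {}" "b \<in> B"
  shows "nb E b = {v}"
proof -
  have "(b, i) \<in> E \<longleftrightarrow> i = v" for i
    using mem_B[OF assms(2)] assms(1) by blast
  then show ?thesis
    by auto
qed

lemma one_private_neighbour:
  assumes C: "card C = 2" and F: "F = {}" and A: "card A = 1"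
  shows "shape4 n E"
proof -
  note D = bicyclic_arcsD[OF bic]
  obtain p q where pq: "C = {p, q}" "p \<noteq> q"
    using C by (metis card_2_iff)
  obtain t where t: "A = {t}"
    using A by (metis card_1_singletonE)
  have nbu: "nb E u = {v, p, q, t}"
    using edge pq t by auto
  have tm: "t \<in> A" "p \<in> C" "q \<in> C"
    using t pq by auto
  then have neq: "distinct [v, u, p, q, t]" and sub: "{v, u, p, q, t} \<subseteq> {..<n}"
    using uv pq D(2) by auto
  have nbv: "nb E v = {u, p, q} \<union> ({..<n} - {v, u, p, q, t})"
    using cover uv nbu pq tm by auto
  have "E = symedges ({(v, u), (v, p), (v, q), (u, p), (u, q), (u, t)} \<union> {v} \<times> ({..<n} - {v, u, p, q, t}))"
    by (subst E_decomp) (simp only: nbu nbv F, auto simp: symedges_def)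
  then show ?thesis
    unfolding shape4_def using neq sub
    by (intro exI[of _ v] exI[of _ u] exI[of _ p] exI[of _ q] exI[of _ t] conjI)
qed

end

context bicyclic_weight
begin

lemma not_dominated_improves:
  assumes bic: "bicyclic_arcs n E" and n6: "6 \<le> n" and nd: "\<not> dominated n E"
    and shapes: "\<not> shape3 n E" "\<not> shape4 n E"
  shows "\<exists>E'. bicyclic_arcs n E' \<and> \<not> dominated n E' \<and> R E < R E'"
proof (rule ccontr)
  assume stuck: "\<not> ?thesis"
  note D = bicyclic_arcsD[OF bic]
  obtain u v where uv: "(u, v) \<in> E" "nb E u - insert v (nb E v) \<noteq> {}" "nb E v - insert u (nb E u) \<noteq> {}"
    by (rule not_dominated_private_neighbours[OF bic n nd])
  have nested: "nb E p \<subseteq> nb E q \<or> nb E q \<subseteq> nb E p"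
    if "p \<noteq> q" "(p, q) \<notin> E" "(p, w) \<in> E" "(q, w) \<in> E" for p q w
  proof -
    have "(q, p) \<notin> E"
      using that(2) D(3) by blast
    then show ?thesis
      using kelmans_improves[OF bic nd, of p q] stuck that by blast
  qed
  have adjacent: "nb E p \<subseteq> insert q (nb E q) \<or> nb E q \<subseteq> insert p (nb E p) \<or> nb E p \<union> nb E q = {..<n}"
    if "(p, q) \<in> E" for p q
  proof -
    have "p \<noteq> q"
      using that D(4) by blast
    then show ?thesis
      using kelmans_improves[OF bic nd, of p q] stuck that by blast
  qed
  have "nb E u \<union> nb E v = {..<n}"
    using adjacent[OF uv(1)] uv(2,3) by blast
  then interpret T: tight_pair n E u v
    using bic n6 uv nested adjacent by unfold_locales
  interpret sw: tight_pair n E v u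
    by (rule T.swapped)
  have C: "card T.C = 2" "card (nb E v \<inter> nb E u) = 2" and F: "T.F = {}"
    using T.tight_cases shapes(1) by (auto simp: Int_commute)
  have fin: "finite T.A" "finite T.B"
    using D(8) by auto
  have "card T.A \<noteq> 1" "card T.B \<noteq> 1"
    using T.one_private_neighbour[OF C(1) F] sw.one_private_neighbour[OF C(2)] F shapes(2)
    unfolding T.F_swapped by auto
  moreover have "card T.A \<noteq> 0" "card T.B \<noteq> 0"
    using fin uv by auto
  ultimately have two: "2 \<le> card T.A" "2 \<le> card T.B"
    by linarith+
  obtain x where x: "sqnorm n x = 1" "\<And>i. i < n \<Longrightarrow> 0 < x i"
    "\<And>i. i < n \<Longrightarrow> (\<Sum>j<n. edge_weight f E i j * x j) = R E * x i"
    "qform n (edge_weight f E) x = R E"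
    by (rule perron[OF bic]) (rule that)
  have False if edge: "(p, q) \<in> E" and xqp: "x q \<le> x p"
    and Ap: "2 \<le> card (nb E p - insert q (nb E q))"
    and Bq: "2 \<le> card (nb E q - insert p (nb E p))"
    and pend: "\<And>b. b \<in> nb E q - insert p (nb E p) \<Longrightarrow> nb E b = {q}" for p q
  proof -
    define P where "P = nb E q - insert p (nb E p)"
    have finP: "finite P"
      using D(8) by (simp add: P_def)
    have "P \<noteq> {}"
      using Bq unfolding P_def[symmetric] by auto
    then obtain t where t: "t \<in> P"
      by auto
    have "card (P - {t}) > 0"
      using Bq t finP by (simp add: P_def)
    then have t': "P - {t} \<noteq> {}"
      by (metis card.empty less_irrefl)
    have pend': "nb E b = {q}" if "b \<in> P" for b
      using pend that unfolding P_def .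
    have inc: "bicyclic_arcs n (shift E p q (P - {t})) \<and> R E < R (shift E p q (P - {t}))"
      by (rule pendant_shift_increases[OF bic edge x xqp Ap P_def pend' t t'])
    interpret S: shift_setup n E p q "P - {t}"
    proof unfold_locales
      show "p \<noteq> q" "p < n" "q < n"
        using edge D(1)[OF edge] D(2)[OF edge] D(4)[of p] by auto
    qed (use bic t' in \<open>auto simp: P_def\<close>)
    have "\<not> dominated n (shift E p q (P - {t}))"
    proof
      assume "dominated n (shift E p q (P - {t}))"
      then have "t \<in> nb E p \<union> (P - {t})"
        using S.shift_dominated[OF nd, of t] t D(2) by (auto simp: P_def)
      then show False
        using t by (auto simp: P_def)
    qed
    then show False
      using inc stuck by blast
  qed
  note impossible = this
  have "nb E b = {v}" if "b \<in> T.B" for b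
    using T.pendant_B[OF F that] .
  moreover have "nb E b = {u}" if "b \<in> T.A" for b
    using sw.pendant_B[OF _ that] F unfolding T.F_swapped by blast
  ultimately show False
    using impossible[of u v] impossible[of v u] two uv(1) D(3)[OF uv(1)] by (meson nle_le)
qed

lemma improves:
  assumes bic: "bicyclic_arcs n E" and shape: "\<not> shape1 n E"
  shows "\<exists>E'. bicyclic_arcs n E' \<and> R E < R E'"
proof (cases "dominated n E")
  case True
  then have "shape2 n E"
    using dominated_shapes[OF bic] shape by blast
  then obtain c y p t q where d: "distinct [c, y, p, t, q]" "{c, y, p, t, q} \<subseteq> {..<n}"
    and E: "E = symedges ({(y, p), (t, q)} \<union> {c} \<times> ({..<n} - {c}))"
    unfolding shape2_def by blast
  have nb: "nb E y = {c, p}" "nb E t = {c, q}"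
    using d unfolding E symedges_def by auto
  have "\<exists>p' q'. {p', q'} = {y, t} \<and> bicyclic_arcs n (shift E p' q' (nb E q' - insert p' (nb E p'))) \<and>
    R E < R (shift E p' q' (nb E q' - insert p' (nb E p')))"
  proof (rule kelmans_increases[OF bic])
    have "c \<in> nb E y" "c \<in> nb E t"
      using nb by auto
    then show "(y, t) \<in> E \<or> (\<exists>w. (y, w) \<in> E \<and> (t, w) \<in> E)"
      by auto
    have "p \<in> nb E y - insert t (nb E t)" "q \<in> nb E t - insert y (nb E y)"
      using nb d by auto
    then show "nb E y - insert t (nb E t) \<noteq> {}" "nb E t - insert y (nb E y) \<noteq> {}"
      by blast+
  qed (use d in auto)
  then show ?thesis
    by blast
next
  case False
  then obtain u v where uv: "(u, v) \<in> E" "nb E u - insert v (nb E v) \<noteq> {}" "nb E v - insert u (nb E u) \<noteq> {}"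
    using not_dominated_private_neighbours[OF bic n] by blast
  then show ?thesis
    using kelmans_increases[OF bic, of u v] bicyclic_arcsD(1,2,4)[OF bic] by blast
qed

end

section \<open>Isomorphism and the extremal graphs\<close>

lemma bij_betw_extending_lists:
  assumes "distinct xs" "set xs \<subseteq> {..<n}" "distinct ys" "set ys \<subseteq> {..<n::nat}"
    and "length xs = length ys"
  obtains s where "bij_betw s {..<n} {..<n}" "map s xs = ys"
proof -
  have "bij_betw ((!) ys \<circ> inv_into {..<length xs} ((!) xs)) (set xs) (set ys)"
    using bij_betw_inv_into[OF bij_betw_nth[OF assms(1) refl refl]]
      bij_betw_nth[OF assms(3) assms(5)[THEN arg_cong, of lessThan] refl]
    by (rule bij_betw_trans)
  then obtain g where g: "bij_betw g (set xs) (set ys)"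
    "\<And>i. i < length xs \<Longrightarrow> g (xs ! i) = ys ! i"
    using bij_betw_nth[OF assms(1) refl refl]
    by (metis (no_types, lifting) bij_betw_imp_inj_on comp_apply inv_into_f_f lessThan_iff)
  have "card ({..<n} - set xs) = card ({..<n} - set ys)"
    using assms by (simp add: card_Diff_subset distinct_card)
  then obtain h where h: "bij_betw h ({..<n} - set xs) ({..<n} - set ys)"
    using finite_same_card_bij by (metis finite_Diff finite_lessThan)
  define s where "s = (\<lambda>i. if i \<in> set xs then g i else h i)"
  have "bij_betw s (set xs) (set ys)"
    using g(1) by (subst bij_betw_cong[of _ _ g]) (auto simp: s_def)
  moreover have "bij_betw s ({..<n} - set xs) ({..<n} - set ys)"
    using h by (subst bij_betw_cong[of _ _ h]) (auto simp: s_def)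
  ultimately have "bij_betw s (set xs \<union> ({..<n} - set xs)) (set ys \<union> ({..<n} - set ys))"
    by (rule bij_betw_combine) auto
  moreover have "map s xs = ys"
    using g(2) assms(5) by (intro nth_equalityI) (auto simp: s_def)
  ultimately show thesis
    using that assms(2,4) by (simp add: Un_absorb1 Un_Diff_cancel)
qed

definition isomorphic :: "nat \<Rightarrow> (nat \<times> nat) set \<Rightarrow> (nat \<times> nat) set \<Rightarrow> bool" where
  "isomorphic n E E' \<longleftrightarrow> (\<exists>s. bij_betw s {..<n} {..<n} \<and> E' = map_prod s s ` E)"

lemma symedges_image: "map_prod s s ` symedges X = symedges (map_prod s s ` X)"
  by (auto simp: symedges_def image_iff)

lemma star_image:
  assumes "bij_betw s {..<n} {..<n}" "X \<subseteq> {..<n}"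
  shows "map_prod s s ` ({c} \<times> ({..<n} - X)) = {s c} \<times> ({..<n} - s ` X)"
proof -
  have "s ` ({..<n} - X) = {..<n} - s ` X"
    using assms by (metis Diff_subset bij_betw_def inj_on_image_set_diff subset_refl)
  moreover have "map_prod s s ` ({c} \<times> ({..<n} - X)) = {s c} \<times> s ` ({..<n} - X)"
    by auto
  ultimately show ?thesis
    by simp
qed

lemma shape1_isomorphic:
  assumes "shape1 n E" "shape1 n E'"
  shows "isomorphic n E E'"
proof -
  obtain c y p q where E: "distinct [c, y, p, q]" "{c, y, p, q} \<subseteq> {..<n}"
    "E = symedges ({(y, p), (y, q)} \<union> {c} \<times> ({..<n} - {c}))"
    using assms(1) unfolding shape1_def by blast
  obtain c' y' p' q' where E': "distinct [c', y', p', q']" "{c', y', p', q'} \<subseteq> {..<n}"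
    "E' = symedges ({(y', p'), (y', q')} \<union> {c'} \<times> ({..<n} - {c'}))"
    using assms(2) unfolding shape1_def by blast
  obtain s where s: "bij_betw s {..<n} {..<n}" "map s [c, y, p, q] = [c', y', p', q']"
    using bij_betw_extending_lists[of "[c, y, p, q]" n "[c', y', p', q']"] E(1,2) E'(1,2) by auto
  have "map_prod s s ` E = E'"
    unfolding E(3) E'(3) symedges_image image_Un using s(2) E(2)
    by (subst star_image[OF s(1)]) auto
  then show ?thesis
    using s(1) unfolding isomorphic_def by blast
qed

lemma shape2_isomorphic:
  assumes "shape2 n E" "shape2 n E'"
  shows "isomorphic n E E'"
proof -
  obtain c y p t q where E: "distinct [c, y, p, t, q]" "{c, y, p, t, q} \<subseteq> {..<n}"
    "E = symedges ({(y, p), (t, q)} \<union> {c} \<times> ({..<n} - {c}))"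
    using assms(1) unfolding shape2_def by blast
  obtain c' y' p' t' q' where E': "distinct [c', y', p', t', q']" "{c', y', p', t', q'} \<subseteq> {..<n}"
    "E' = symedges ({(y', p'), (t', q')} \<union> {c'} \<times> ({..<n} - {c'}))"
    using assms(2) unfolding shape2_def by blast
  obtain s where s: "bij_betw s {..<n} {..<n}" "map s [c, y, p, t, q] = [c', y', p', t', q']"
    using bij_betw_extending_lists[of "[c, y, p, t, q]" n "[c', y', p', t', q']"] E(1,2) E'(1,2) by auto
  have "map_prod s s ` E = E'"
    unfolding E(3) E'(3) symedges_image image_Un using s(2) E(2)
    by (subst star_image[OF s(1)]) auto
  then show ?thesis
    using s(1) unfolding isomorphic_def by blast
qed

lemma shape3_isomorphic:
  assumes "shape3 n E" "shape3 n E'"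
  shows "isomorphic n E E'"
proof -
  obtain x y v w where E: "distinct [x, y, v, w]" "{x, y, v, w} \<subseteq> {..<n}"
    "E = symedges ({(x, y), (x, v), (x, w), (y, v), (y, w)} \<union> {v} \<times> ({..<n} - {x, y, v, w}))"
    using assms(1) unfolding shape3_def by blast
  obtain x' y' v' w' where E': "distinct [x', y', v', w']" "{x', y', v', w'} \<subseteq> {..<n}"
    "E' = symedges ({(x', y'), (x', v'), (x', w'), (y', v'), (y', w')} \<union>
      {v'} \<times> ({..<n} - {x', y', v', w'}))"
    using assms(2) unfolding shape3_def by blast
  obtain s where s: "bij_betw s {..<n} {..<n}" "map s [x, y, v, w] = [x', y', v', w']"
    using bij_betw_extending_lists[of "[x, y, v, w]" n "[x', y', v', w']"] E(1,2) E'(1,2) by auto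
  have "map_prod s s ` E = E'"
    unfolding E(3) E'(3) symedges_image image_Un star_image[OF s(1) E(2)] using s(2) by simp
  then show ?thesis
    using s(1) unfolding isomorphic_def by blast
qed

lemma shape4_isomorphic:
  assumes "shape4 n E" "shape4 n E'"
  shows "isomorphic n E E'"
proof -
  obtain x y v w t where E: "distinct [x, y, v, w, t]" "{x, y, v, w, t} \<subseteq> {..<n}"
    "E = symedges ({(x, y), (x, v), (x, w), (y, v), (y, w), (y, t)} \<union>
      {x} \<times> ({..<n} - {x, y, v, w, t}))"
    using assms(1) unfolding shape4_def by blast
  obtain x' y' v' w' t' where E': "distinct [x', y', v', w', t']" "{x', y', v', w', t'} \<subseteq> {..<n}"
    "E' = symedges ({(x', y'), (x', v'), (x', w'), (y', v'), (y', w'), (y', t')} \<union>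
      {x'} \<times> ({..<n} - {x', y', v', w', t'}))"
    using assms(2) unfolding shape4_def by blast
  obtain s where s: "bij_betw s {..<n} {..<n}" "map s [x, y, v, w, t] = [x', y', v', w', t']"
    using bij_betw_extending_lists[of "[x, y, v, w, t]" n "[x', y', v', w', t']"] E(1,2) E'(1,2) by auto
  have "map_prod s s ` E = E'"
    unfolding E(3) E'(3) symedges_image image_Un star_image[OF s(1) E(2)] using s(2) by simp
  then show ?thesis
    using s(1) unfolding isomorphic_def by blast
qed

lemma isomorphic_spec_rad:
  assumes "isomorphic n E E'" "E \<subseteq> {..<n} \<times> {..<n}"
  shows "spec_rad n (edge_weight f E') = spec_rad n (edge_weight f E)"
proof -
  obtain s where s: "bij_betw s {..<n} {..<n}" "E' = map_prod s s ` E"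
    using assms(1) by (auto simp: isomorphic_def)
  have inj: "inj_on s {..<n}"
    using s(1) by (rule bij_betw_imp_inj_on)
  have mem: "(s i, s j) \<in> E' \<longleftrightarrow> (i, j) \<in> E" if "i < n" "j < n" for i j
    using that assms(2) inj unfolding s(2) by (auto dest: inj_onD)
  have "nb E' (s i) = s ` nb E i" if "i < n" for i
    using that assms(2) inj unfolding s(2) by (auto simp: image_iff dest: inj_onD)
  moreover have "inj_on s (nb E i)" for i
    using inj by (rule inj_on_subset) (use assms(2) in auto)
  ultimately have "dg E' (s i) = dg E i" if "i < n" for i
    using that by (simp add: card_image)
  then show ?thesis
    using mem by (intro spec_rad_permute[OF s(1)]) (simp add: edge_weight_def)
qed

lemma isomorphic_digraph_iso:
  assumes "pair_wf_digraph G" "pverts G = {0..<n}" "pverts H = {0..<n}"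
    and "isomorphic n (parcs G) (parcs H)"
  shows "digraph_iso (with_proj G) (with_proj H)"
proof -
  obtain s where s: "bij_betw s {..<n} {..<n}" "parcs H = map_prod s s ` parcs G"
    using assms(4) by (auto simp: isomorphic_def)
  have inj: "inj_on s {0..<n}"
    using s(1) by (simp add: bij_betw_def atLeast0LessThan)
  have sub: "parcs G \<subseteq> {0..<n} \<times> {0..<n}"
    using assms(1,2) by (auto simp: pair_wf_digraph_def)
  define hom where "hom = \<lparr>iso_verts = s, iso_arcs = map_prod s s, iso_head = snd, iso_tail = fst\<rparr>"
  have "pre_digraph.digraph_isomorphism (with_proj G) hom"
    unfolding pre_digraph.digraph_isomorphism_def
  proof (intro conjI ballI)
    show "wf_digraph (with_proj G)"
      using assms(1) by (simp add: wf_digraph_wp_iff)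
    show "inj_on (iso_verts hom) (verts (with_proj G))"
      using inj assms(2) by (simp add: hom_def)
    show "inj_on (iso_arcs hom) (arcs (with_proj G))"
      using inj_on_subset[OF map_prod_inj_on[OF inj inj] sub] by (simp add: hom_def)
  qed (auto simp: hom_def)
  moreover have "with_proj H = app_iso hom (with_proj G)"
    using s assms(2,3) by (simp add: with_proj_def app_iso_def hom_def bij_betw_def atLeast0LessThan)
  ultimately show ?thesis
    unfolding digraph_iso_def by blast
qed

lemma bicyclic_iff_arcs: "bicyclic n G \<longleftrightarrow> n > 0 \<and> pverts G = {0..<n} \<and> bicyclic_arcs n (parcs G)"
proof (cases "pverts G = {0..<n} \<and> parcs G \<subseteq> {..<n} \<times> {..<n} \<and> sym (parcs G)")
  case True
  have "finite (parcs G)"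
    using True by (meson finite_SigmaI finite_lessThan finite_subset)
  then have "pair_graph G \<longleftrightarrow> irrefl (parcs G)"
    using True
    by (auto simp: pair_graph_def pair_digraph_def pair_fin_digraph_def pair_fin_digraph_axioms_def
        pair_wf_digraph_def pair_loopfree_digraph_def pair_loopfree_digraph_axioms_def
        pair_pseudo_graph_def pair_sym_digraph_def pair_sym_digraph_axioms_def irrefl_def
        symmetric_def)
  moreover have "(i, j) \<in> rtrancl_on {0..<n} (parcs G) \<longleftrightarrow> (i, j) \<in> (parcs G)\<^sup>*"
    if "i < n" "j < n" for i j
  proof
    assume "(i, j) \<in> (parcs G)\<^sup>*"
    then show "(i, j) \<in> rtrancl_on {0..<n} (parcs G)"
      by (rule rtrancl_consistent_rtrancl_on) (use that True in auto)
  qed (rule rtrancl_on_rtranclI)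
  moreover have "symcl (parcs G) = parcs G"
    using True by (auto simp: symcl_def dest: symD)
  ultimately show ?thesis
    using True by (auto simp: bicyclic_def bicyclic_arcs_def connected_conv)
next
  case False
  have "pair_graph G \<Longrightarrow> sym (parcs G)"
    by (auto simp: sym_def dest: pair_sym_digraph.arcs_symmetric[OF pair_pseudo_graph.axioms(2)]
        pair_graph.axioms(2))
  moreover have "pair_graph G \<Longrightarrow> pverts G = {0..<n} \<Longrightarrow> parcs G \<subseteq> {..<n} \<times> {..<n}"
    by (auto simp: pair_graph_def pair_digraph_def pair_fin_digraph_def pair_wf_digraph_def)
  ultimately show ?thesis
    using False by (auto simp: bicyclic_def bicyclic_arcs_def)
qed

lemma deg_eq: "deg G v = real (dg (parcs G) v)"
proof -
  have "out_arcs (with_proj G) v = Pair v ` nb (parcs G) v"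
    by (auto simp: out_arcs_def image_iff)
  then show ?thesis
    by (simp add: deg_def out_degree_def card_image inj_on_def)
qed

lemma rho_eq: "rho f n G = spec_rad n (edge_weight f (parcs G))"
  unfolding rho_def spec_rad_def weighted_adjacency_mat_def
  by (rule arg_cong[of _ _ spectral_radius]) (auto simp: edge_weight_def deg_eq)

lemma G2_shape:
  assumes "5 \<le> n"
  shows "pverts (G2 n) = {0..<n}" "shape2 n (parcs (G2 n))"
proof -
  show "pverts (G2 n) = {0..<n}"
    using assms by (auto simp: G2_def attach_pendants_def two_triangles_def graph_of_edges_def Let_def)
  have "{..<n} - {0} = {1, 2, 3, 4} \<union> {5..<n}"
    using assms by auto
  then have "parcs (G2 n) = symedges ({(1, 2), (3, 4)} \<union> {0} \<times> ({..<n} - {0}))"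
    using assms unfolding G2_def attach_pendants_def two_triangles_def graph_of_edges_def Let_def symedges_def
    by auto
  moreover have "distinct [0, 1, 2, 3, 4 :: nat]" "{0, 1, 2, 3, 4} \<subseteq> {..<n}"
    using assms by auto
  ultimately show "shape2 n (parcs (G2 n))"
    unfolding shape2_def by blast
qed

lemma G3_shape:
  assumes "4 \<le> n"
  shows "pverts (G3 n) = {0..<n}" "shape3 n (parcs (G3 n))"
proof -
  show "pverts (G3 n) = {0..<n}"
    using assms by (auto simp: G3_def attach_pendants_def K4_minus_def graph_of_edges_def Let_def)
  have "{..<n} - {0, 1, 2, 3} = {4..<n}"
    by auto
  then have "parcs (G3 n) = symedges ({(0, 1), (0, 2), (0, 3), (1, 2), (1, 3)} \<union> {2} \<times> ({..<n} - {0, 1, 2, 3}))"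
    using assms unfolding G3_def attach_pendants_def K4_minus_def graph_of_edges_def Let_def symedges_def
    by auto
  moreover have "distinct [0, 1, 2, 3 :: nat]" "{0, 1, 2, 3} \<subseteq> {..<n}"
    using assms by auto
  ultimately show "shape3 n (parcs (G3 n))"
    unfolding shape3_def by blast
qed

lemma G4_shape:
  assumes "5 \<le> n"
  shows "pverts (G4 n) = {0..<n}" "shape4 n (parcs (G4 n))"
proof -
  let ?H = "attach_pendants K4_minus 0 (n - 5)"
  have H: "pverts ?H = {0..<n - 1}"
    "parcs ?H = {(0, 1), (0, 2), (0, 3), (1, 2), (1, 3)} \<union> {(0, 1), (0, 2), (0, 3), (1, 2), (1, 3)}\<inverse>
      \<union> {0} \<times> {4..<n - 1} \<union> {4..<n - 1} \<times> {0}"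
    using assms by (auto simp: attach_pendants_def K4_minus_def graph_of_edges_def Let_def)
  have last: "{n - 1..<n - 1 + 1} = {n - 1}"
    by auto
  show "pverts (G4 n) = {0..<n}"
    using assms unfolding G4_def attach_pendants_def[of ?H] H Let_def by auto
  have rest: "{..<n} - {0, 1, 2, 3, n - 1} = {4..<n - 1}"
    using assms by auto
  have "parcs (G4 n) = symedges ({(0, 1), (0, 2), (0, 3), (1, 2), (1, 3), (1, n - 1)} \<union>
      {0} \<times> ({..<n} - {0, 1, 2, 3, n - 1}))"
    unfolding rest G4_def attach_pendants_def[of ?H] H Let_def symedges_def card_atLeastLessThan
      diff_zero last by auto
  moreover have "distinct [0, 1, 2, 3, n - 1 :: nat]" "{0, 1, 2, 3, n - 1} \<subseteq> {..<n}"
    using assms by auto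
  ultimately show "shape4 n (parcs (G4 n))"
    unfolding shape4_def by blast
qed

lemma shape2_bicyclic_arcs:
  assumes "shape2 n E"
  shows "bicyclic_arcs n E"
proof -
  obtain c y p t q where d: "distinct [c, y, p, t, q]" "{c, y, p, t, q} \<subseteq> {..<n}"
    and E: "E = symedges ({(y, p), (t, q)} \<union> {c} \<times> ({..<n} - {c}))"
    using assms unfolding shape2_def by blast
  have sub: "E \<subseteq> {..<n} \<times> {..<n}"
    using d(2) by (auto simp: E symedges_def)
  have sym: "sym E" "irrefl E"
    using d(1) by (auto simp: E symedges_def sym_def irrefl_def)
  have "(i, j) \<in> E\<^sup>*" if "i < n" "j < n" for i j
  proof -
    have "(i, c) \<in> E\<^sup>*" "(c, j) \<in> E\<^sup>*"
      using that by (cases "i = c"; cases "j = c"; auto simp: E symedges_def)+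
    then show ?thesis
      by (rule rtrancl_trans)
  qed
  moreover have "card E = 2 * (n + 1)"
  proof -
    have "finite E"
      using sub by (rule finite_subset) simp
    then have "card E = card (E \<inter> ((- {c}) \<times> (- {c}))) + 2 * dg E c"
      using sym by (rule card_remove_vertex)
    moreover have "E \<inter> ((- {c}) \<times> (- {c})) = {(y, p), (p, y), (t, q), (q, t)}"
      using d(1) by (auto simp: E symedges_def)
    moreover have "nb E c = {..<n} - {c}"
      using d(1) by (auto simp: E symedges_def)
    moreover have "card {(y, p), (p, y), (t, q), (q, t)} = 4" "c < n"
      using d by simp_all
    ultimately show ?thesis
      by simp
  qed
  ultimately show ?thesis
    using sub sym by (simp add: bicyclic_arcs_def)
qed

lemma shape2_not_shape1:
  assumes "6 \<le> n" "shape2 n E"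
  shows "\<not> shape1 n E"
proof
  assume "shape1 n E"
  then obtain c y p q where d: "distinct [c, y, p, q]" "{c, y, p, q} \<subseteq> {..<n}"
    and E: "E = symedges ({(y, p), (y, q)} \<union> {c} \<times> ({..<n} - {c}))"
    unfolding shape1_def by blast
  obtain c' y' p' t' q' where d': "distinct [c', y', p', t', q']" "{c', y', p', t', q'} \<subseteq> {..<n}"
    and E': "E = symedges ({(y', p'), (t', q')} \<union> {c'} \<times> ({..<n} - {c'}))"
    using assms(2) unfolding shape2_def by blast
  have "card {c', y', p', t', q'} \<le> 5"
    by (simp add: card_insert_if)
  then have "\<not> {..<n} \<subseteq> {c', y', p', t', q'}"
    using assms(1) card_mono[of "{c', y', p', t', q'}" "{..<n}"] by auto
  then obtain l where l: "l < n" "l \<notin> {c', y', p', t', q'}"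
    by auto
  have nbl: "nb E l = {c'}"
    using l unfolding E' symedges_def by auto
  have dom: "(c, i) \<in> E" "(i, c) \<in> E" if "i < n" "i \<noteq> c" for i
    using that by (auto simp: E symedges_def)
  have "c = c'"
  proof (cases "l = c")
    case True
    then have "y' \<in> nb E l"
      using dom(1)[of y'] l d' by auto
    then show ?thesis
      using nbl d' by auto
  next
    case False
    then show ?thesis
      using dom(2)[OF l(1)] nbl by auto
  qed
  then have "(y, p) \<in> {(y', p'), (p', y'), (t', q'), (q', t')}" "(y, q) \<in> {(y', p'), (p', y'), (t', q'), (q', t')}"
  proof -
    have "(y, p) \<in> E" "(y, q) \<in> E"
      by (auto simp: E symedges_def)
    then show "(y, p) \<in> {(y', p'), (p', y'), (t', q'), (q', t')}"
      "(y, q) \<in> {(y', p'), (p', y'), (t', q'), (q', t')}"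
      unfolding E' symedges_def using d(1) \<open>c = c'\<close> by auto
  qed
  then show False
    using d(1) d'(1) by auto
qed

lemma shape1_dominated:
  assumes "shape1 n E"
  shows "dominated n E"
proof -
  obtain c y p q where "{c, y, p, q} \<subseteq> {..<n}"
    "E = symedges ({(y, p), (y, q)} \<union> {c} \<times> ({..<n} - {c}))"
    using assms unfolding shape1_def by blast
  then have "c < n" "\<forall>j<n. j \<noteq> c \<longrightarrow> (c, j) \<in> E"
    by (auto simp: symedges_def)
  then show ?thesis
    unfolding dominated_def by blast
qed

lemma finite_bicyclic_arcs: "finite {E. bicyclic_arcs n E}"
  by (rule finite_subset[of _ "Pow ({..<n} \<times> {..<n})"]) (auto simp: bicyclic_arcs_def)

theorem theorem3p1:
  fixes n :: nat and f :: "real \<Rightarrow> real \<Rightarrow> real"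
  assumes "n \<ge> 6"
    and "symmetric_weight f"
    and "property_P_star f"
    and "\<And>G i j. bicyclic n G \<Longrightarrow> (i, j) \<in> parcs G \<Longrightarrow> f (deg G i) (deg G j) > 0"
  shows "(\<exists>G. bicyclic n G \<and> second_largest_in (rho f n ` {H. bicyclic n H}) (rho f n G)) \<and>
    (\<forall>G. bicyclic n G \<and> second_largest_in (rho f n ` {H. bicyclic n H}) (rho f n G) \<longrightarrow>
       digraph_iso (with_proj G) (with_proj (G2 n)) \<or>
       digraph_iso (with_proj G) (with_proj (G3 n)) \<or>
       digraph_iso (with_proj G) (with_proj (G4 n)))"
proof -
  have n: "n > 0"
    using assms(1) by simp
  have graph: "bicyclic n \<lparr>pverts = {0..<n}, parcs = E\<rparr>" if "bicyclic_arcs n E" for E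
    using that n by (simp add: bicyclic_iff_arcs)
  interpret bicyclic_weight n f
  proof
    fix E i j assume "bicyclic_arcs n E" "(i, j) \<in> E"
    then show "0 < f (real (dg E i)) (real (dg E j))"
      using assms(4)[OF graph, of E i j] by (simp add: deg_eq)
  qed (use n assms in auto)
  define S where "S = R ` {E. bicyclic_arcs n E}"
  have S: "rho f n ` {H. bicyclic n H} = S"
  proof (intro equalityI subsetI)
    fix r assume "r \<in> rho f n ` {H. bicyclic n H}"
    then show "r \<in> S"
      by (auto simp: S_def rho_eq bicyclic_iff_arcs)
  next
    fix r assume "r \<in> S"
    then obtain E where "bicyclic_arcs n E" "r = R E"
      by (auto simp: S_def)
    then show "r \<in> rho f n ` {H. bicyclic n H}"
      using graph by (intro image_eqI[of _ _ "\<lparr>pverts = {0..<n}, parcs = E\<rparr>"]) (auto simp: rho_eq)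
  qed
  have fin: "finite S"
    unfolding S_def by (intro finite_imageI finite_bicyclic_arcs)
  have E0: "bicyclic_arcs n (parcs (G2 n))" "\<not> shape1 n (parcs (G2 n))"
    using G2_shape(2) shape2_bicyclic_arcs shape2_not_shape1 assms(1) by auto
  have "S \<noteq> {}"
    using E0(1) by (auto simp: S_def)
  then have "Max S \<in> S"
    using fin by simp
  then obtain M where M: "bicyclic_arcs n M" "R M = Max S"
    by (auto simp: S_def)
  have less: "R E < Max S" if E: "bicyclic_arcs n E" "\<not> shape1 n E" for E
  proof -
    obtain E' where "bicyclic_arcs n E'" "R E < R E'"
      using improves[OF E] by blast
    moreover from this have "R E' \<le> Max S"
      using fin by (intro Max_ge) (auto simp: S_def)
    ultimately show ?thesis
      by simp
  qed
  have "shape1 n M"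
    using less[OF M(1)] M(2) by auto
  then have top: "R E = Max S" if "shape1 n E" for E
    using isomorphic_spec_rad[OF shape1_isomorphic[of n M E]] that M by (auto simp: bicyclic_arcs_def)
  have "second_largest_in S (Max (S - {Max S}))"
  proof -
    have "R (parcs (G2 n)) \<in> S - {Max S}"
      using E0 less[OF E0] by (auto simp: S_def)
    then have ne: "S - {Max S} \<noteq> {}"
      by blast
    have mem: "Max (S - {Max S}) \<in> S - {Max S}"
      using fin ne by (intro Max_in) auto
    have "s = Max S" if "s \<in> S" "Max (S - {Max S}) < s" for s
    proof (rule ccontr)
      assume "s \<noteq> Max S"
      then have "s \<le> Max (S - {Max S})"
        using that(1) fin by (intro Max_ge) auto
      then show False
        using that(2) by simp
    qed
    moreover have "Max (S - {Max S}) \<le> Max S"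
      using mem fin by (intro Max_ge) auto
    then have "Max (S - {Max S}) < Max S"
      using mem by (metis DiffE insertI1 order_le_less)
    ultimately have "{s \<in> S. Max (S - {Max S}) < s} = {Max S}"
      using \<open>Max S \<in> S\<close> by auto
    then show ?thesis
      using mem by (simp add: second_largest_in_def)
  qed
  moreover obtain E where "bicyclic_arcs n E" "R E = Max (S - {Max S})"
    using calculation by (auto simp: second_largest_in_def S_def)
  ultimately have "\<exists>G. bicyclic n G \<and> second_largest_in S (rho f n G)"
    using graph by (intro exI[of _ "\<lparr>pverts = {0..<n}, parcs = E\<rparr>"]) (auto simp: rho_eq)
  moreover have "digraph_iso (with_proj G) (with_proj (G2 n)) \<or>
      digraph_iso (with_proj G) (with_proj (G3 n)) \<or>
      digraph_iso (with_proj G) (with_proj (G4 n))"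
    if G: "bicyclic n G" and second: "second_largest_in S (rho f n G)" for G
  proof -
    define E where "E = parcs G"
    have E: "bicyclic_arcs n E" "pverts G = {0..<n}"
      using G by (auto simp: bicyclic_iff_arcs E_def)
    have wf: "pair_wf_digraph G"
      using G by (auto simp: bicyclic_def pair_graph_def pair_digraph_def pair_fin_digraph_def)
    have one: "card {s \<in> S. R E < s} = 1"
      using second by (simp add: second_largest_in_def rho_eq E_def)
    have "\<not> shape1 n E"
    proof
      assume "shape1 n E"
      then have none: "{s \<in> S. R E < s} = {}"
        using top fin Max_ge by (auto simp: not_less)
      show False
        using one unfolding none by simp
    qed
    then consider "shape2 n E" | "\<not> dominated n E"
      using dominated_shapes[OF E(1)] by blast
    then have "shape2 n E \<or> shape3 n E \<or> shape4 n E"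
    proof cases
      case 2
      show ?thesis
      proof (rule ccontr)
        assume "\<not> ?thesis"
        then obtain E' where E': "bicyclic_arcs n E'" "\<not> dominated n E'" "R E < R E'"
          using not_dominated_improves[OF E(1) assms(1) 2] by blast
        then have "R E' < Max S"
          using less shape1_dominated by blast
        then have "{R E', Max S} \<subseteq> {s \<in> S. R E < s}"
          using E' \<open>Max S \<in> S\<close> by (auto simp: S_def)
        then have "card {R E', Max S} \<le> card {s \<in> S. R E < s}"
          using fin by (intro card_mono) auto
        then show False
          using one \<open>R E' < Max S\<close> by simp
      qed
    qed simp
    moreover have n45: "5 \<le> n" "4 \<le> n"
      using assms(1) by auto
    ultimately have "isomorphic n E (parcs (G2 n)) \<or> isomorphic n E (parcs (G3 n)) \<or> isomorphic n E (parcs (G4 n))"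
      using shape2_isomorphic[OF _ G2_shape(2)[OF n45(1)], of E]
        shape3_isomorphic[OF _ G3_shape(2)[OF n45(2)], of E]
        shape4_isomorphic[OF _ G4_shape(2)[OF n45(1)], of E] by blast
    then show ?thesis
      unfolding E_def
      using isomorphic_digraph_iso[OF wf E(2) G2_shape(1)[OF n45(1)]]
        isomorphic_digraph_iso[OF wf E(2) G3_shape(1)[OF n45(2)]]
        isomorphic_digraph_iso[OF wf E(2) G4_shape(1)[OF n45(1)]] by blast
  qed
  ultimately show ?thesis
    unfolding S by blast
qed

end
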